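(* Let $K$ be a field and let $D_n(K)$ be the skewfield of fractions of the Weyl algebra $A_n(K)$. Then every valuation $v:K\to\Gamma\cup\{\infty\}$ (surjective onto a totally ordered group $\Gamma$) extends to $D_n(K)$; that is, there is a valuation $w:D_n(K)\to\Gamma\cup\{\infty\}$ with $w|_K=v$.
   Context: $A_n(K)$ is the $K$-algebra generated by $x_1,\dots,x_n,y_1,\dots,y_n$ with relations $[x_i,x_j]=[y_i,y_j]=0$ and $[y_i,x_j]=\delta_{ij}$. A valuation on a skewfield $D$ is a map $w:D\to\Gamma\cup\{\infty\}$, $\Gamma$ a totally ordered group, with $w(x)=\infty$ iff $x=0$, $w(xy)=w(x)+w(y)$, $w(x+y)\ge\min\{w(x),w(y)\}$. *)

theory Defs
  imports "HOL-Library.Poly_Mapping" "HOL-Library.Extended_Nat"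
begin

section \<open>Totally ordered groups and valuations\<close>

text \<open>Written additively, but not assumed commutative.\<close>

class linordered_group_add = group_add + linorder +
  assumes add_left_mono_group: "a \<le> b \<Longrightarrow> c + a \<le> c + b"
    and add_right_mono_group: "a \<le> b \<Longrightarrow> a + c \<le> b + c"

subclass (in linordered_ab_group_add) linordered_group_add
  by standard (simp_all add: add_left_mono add_right_mono)

datatype 'g with_infty = Fin 'g | Infty

instantiation with_infty :: (type) infinity
begin
definition infinity_with_infty :: "'a with_infty" where "\<infinity> = Infty"
instance ..
end

instantiation with_infty :: (plus) plus
begin
fun plus_with_infty :: "'a with_infty \<Rightarrow> 'a with_infty \<Rightarrow> 'a with_infty" where
  "Fin a + Fin b = Fin (a + b)"
| "Infty + y = Infty"
| "x + Infty = Infty"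
instance ..
end

instantiation with_infty :: (linorder) linorder
begin
definition less_eq_with_infty :: "'a with_infty \<Rightarrow> 'a with_infty \<Rightarrow> bool" where
  "x \<le> y \<longleftrightarrow> (case y of Infty \<Rightarrow> True | Fin b \<Rightarrow> (case x of Infty \<Rightarrow> False | Fin a \<Rightarrow> a \<le> b))"
definition less_with_infty :: "'a with_infty \<Rightarrow> 'a with_infty \<Rightarrow> bool" where
  "(x :: 'a with_infty) < y \<longleftrightarrow> x \<le> y \<and> \<not> y \<le> x"
instance
proof
  fix x y z :: "'a with_infty"
  show "x < y \<longleftrightarrow> x \<le> y \<and> \<not> y \<le> x" by (rule less_with_infty_def)
  show "x \<le> x" by (cases x) (auto simp: less_eq_with_infty_def)
  show "x \<le> y \<Longrightarrow> y \<le> z \<Longrightarrow> x \<le> z" by (cases x; cases y; cases z) (auto simp: less_eq_with_infty_def)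
  show "x \<le> y \<Longrightarrow> y \<le> x \<Longrightarrow> x = y" by (cases x; cases y) (auto simp: less_eq_with_infty_def)
  show "x \<le> y \<or> y \<le> x" by (cases x; cases y) (auto simp: less_eq_with_infty_def)
qed
end

definition valuation :: "('a::division_ring \<Rightarrow> 'g::linordered_group_add with_infty) \<Rightarrow> bool" where
  "valuation w \<longleftrightarrow>
     (\<forall>x. w x = \<infinity> \<longleftrightarrow> x = 0) \<and>
     (\<forall>x y. w (x * y) = w x + w y) \<and>
     (\<forall>x y. w (x + y) \<ge> min (w x) (w y))"


section \<open>Free algebras\<close>

text \<open>
  The free algebra \<open>K\<langle>S\<rangle>\<close> is the monoid algebra of the free monoid on \<open>S\<close>. \<^theory>\<open>HOL-Library.Poly_Mapping\<close>
  takes its monoid in additive notation, so \<open>+\<close> on words is (noncommutative) concatenation.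
\<close>

datatype 's free_monoid = FM (letters: "'s list")

instantiation free_monoid :: (type) monoid_add
begin
definition zero_free_monoid :: "'a free_monoid" where "0 = FM []"
definition plus_free_monoid :: "'a free_monoid \<Rightarrow> 'a free_monoid \<Rightarrow> 'a free_monoid" where
  "u + v = FM (letters u @ letters v)"
instance by standard (simp_all add: zero_free_monoid_def plus_free_monoid_def)
end

type_synonym ('s, 'k) free_algebra = "'s free_monoid \<Rightarrow>\<^sub>0 'k"

definition fa_gen :: "'s \<Rightarrow> ('s, 'k::field) free_algebra" where
  "fa_gen s = Poly_Mapping.single (FM [s]) 1"

definition fa_const :: "'k::field \<Rightarrow> ('s, 'k) free_algebra" where
  "fa_const c = Poly_Mapping.single 0 c"

inductive_set two_sided_ideal :: "'a::ring_1 set \<Rightarrow> 'a set" for S where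
  zero: "0 \<in> two_sided_ideal S"
| gen: "s \<in> S \<Longrightarrow> a * s * b \<in> two_sided_ideal S"
| add: "p \<in> two_sided_ideal S \<Longrightarrow> q \<in> two_sided_ideal S \<Longrightarrow> p + q \<in> two_sided_ideal S"

lemma two_sided_ideal_mult:
  assumes "p \<in> two_sided_ideal S"
  shows "a * p * b \<in> two_sided_ideal S"
  using assms
proof induction
  case (gen s c d)
  then show ?case using two_sided_ideal.gen[of s S "a * c" "d * b"] by (simp add: mult.assoc)
qed (auto simp: distrib_left distrib_right intro: two_sided_ideal.intros)

lemma two_sided_ideal_minus: "p \<in> two_sided_ideal S \<Longrightarrow> - p \<in> two_sided_ideal S"
  using two_sided_ideal_mult[of p S "-1" 1] by simp

lemma two_sided_ideal_diff:
  "p \<in> two_sided_ideal S \<Longrightarrow> q \<in> two_sided_ideal S \<Longrightarrow> p - q \<in> two_sided_ideal S"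
  using two_sided_ideal.add[of p S "- q"] two_sided_ideal_minus[of q S] by simp


section \<open>The Weyl algebra\<close>

text \<open>The generators are indexed by a finite type \<open>'n\<close>; the \<open>n\<close> of \<open>A\<^sub>n(K)\<close> is \<open>CARD('n)\<close>.\<close>

datatype 'n weyl_gen = X 'n | Y 'n

inductive_set weyl_relations :: "('n weyl_gen, 'k::field) free_algebra set" where
  xx: "fa_gen (X i) * fa_gen (X j) - fa_gen (X j) * fa_gen (X i) \<in> weyl_relations"
| yy: "fa_gen (Y i) * fa_gen (Y j) - fa_gen (Y j) * fa_gen (Y i) \<in> weyl_relations"
| yx: "fa_gen (Y i) * fa_gen (X j) - fa_gen (X j) * fa_gen (Y i) - (if i = j then 1 else 0) \<in> weyl_relations"

definition weyl_rel :: "('n weyl_gen, 'k::field) free_algebra \<Rightarrow> ('n weyl_gen, 'k) free_algebra \<Rightarrow> bool" where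
  "weyl_rel p q \<longleftrightarrow> p - q \<in> two_sided_ideal weyl_relations"

lemma equivp_weyl_rel: "equivp weyl_rel"
proof (rule equivpI)
  show "reflp weyl_rel"
    by (auto simp: reflp_def weyl_rel_def intro: two_sided_ideal.zero)
  show "symp weyl_rel"
    unfolding symp_def weyl_rel_def by (auto dest: two_sided_ideal_minus)
  show "transp weyl_rel"
    unfolding transp_def weyl_rel_def by (auto dest: two_sided_ideal.add)
qed

subsection \<open>The Weyl algebra is not the zero ring\<close>

text \<open>
  This is needed for the \<open>ring_1\<close> instance below, since that class includes \<open>0 \<noteq> 1\<close>. The free algebra
  acts on (coefficient families of) formal power series in the \<open>x\<^sub>i\<close>, with \<open>X i\<close> acting as multiplication
  by \<open>x\<^sub>i\<close> and \<open>Y i\<close> as \<open>\<partial>/\<partial>x\<^sub>i\<close>; the ideal of the relations acts as zero.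
\<close>

fun gen_act :: "'n weyl_gen \<Rightarrow> (('n \<Rightarrow> nat) \<Rightarrow> 'k::field) \<Rightarrow> ('n \<Rightarrow> nat) \<Rightarrow> 'k" where
  "gen_act (X i) f = (\<lambda>a. if a i = 0 then 0 else f (a(i := a i - 1)))"
| "gen_act (Y i) f = (\<lambda>a. of_nat (Suc (a i)) * f (a(i := Suc (a i))))"

definition word_act :: "'n weyl_gen free_monoid \<Rightarrow> (('n \<Rightarrow> nat) \<Rightarrow> 'k::field) \<Rightarrow> ('n \<Rightarrow> nat) \<Rightarrow> 'k" where
  "word_act u = foldr gen_act (letters u)"

definition fa_act :: "('n weyl_gen, 'k::field) free_algebra \<Rightarrow> (('n \<Rightarrow> nat) \<Rightarrow> 'k) \<Rightarrow> ('n \<Rightarrow> nat) \<Rightarrow> 'k" where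
  "fa_act p f = (\<lambda>a. \<Sum>u\<in>Poly_Mapping.keys p. Poly_Mapping.lookup p u * word_act u f a)"

lemma gen_act_linear:
  "gen_act g (\<lambda>a. f a + h a) = (\<lambda>a. gen_act g f a + gen_act g h a)"
  "gen_act g (\<lambda>a. c * f a) = (\<lambda>a. c * gen_act g f a)"
  by (cases g; auto simp: fun_eq_iff algebra_simps)+

lemma word_act_linear:
  "word_act u (\<lambda>a. f a + h a) = (\<lambda>a. word_act u f a + word_act u h a)"
  "word_act u (\<lambda>a. c * f a) = (\<lambda>a. c * word_act u f a)"
proof -
  have "foldr gen_act us (\<lambda>a. f a + h a) = (\<lambda>a. foldr gen_act us f a + foldr gen_act us h a)
      \<and> foldr gen_act us (\<lambda>a. c * f a) = (\<lambda>a. c * foldr gen_act us f a)" for us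
    by (induction us) (simp_all add: gen_act_linear)
  then show "word_act u (\<lambda>a. f a + h a) = (\<lambda>a. word_act u f a + word_act u h a)"
    and "word_act u (\<lambda>a. c * f a) = (\<lambda>a. c * word_act u f a)"
    by (simp_all add: word_act_def)
qed

lemma word_act_add: "word_act (u + v) f = word_act u (word_act v f)"
  by (simp add: word_act_def plus_free_monoid_def)

lemma fa_act_superset:
  assumes "finite A" "Poly_Mapping.keys p \<subseteq> A"
  shows "fa_act p f a = (\<Sum>u\<in>A. Poly_Mapping.lookup p u * word_act u f a)"
  unfolding fa_act_def using assms
  by (intro sum.mono_neutral_left) (auto simp: in_keys_iff)

lemma fa_act_add: "fa_act (p + q) f a = fa_act p f a + fa_act q f a"
proof -
  let ?A = "Poly_Mapping.keys p \<union> Poly_Mapping.keys q"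
  have *: "finite ?A" "Poly_Mapping.keys (p + q) \<subseteq> ?A" "Poly_Mapping.keys p \<subseteq> ?A" "Poly_Mapping.keys q \<subseteq> ?A"
    by (auto simp: Poly_Mapping.keys_add)
  show ?thesis
    by (simp add: fa_act_superset[OF *(1,2)] fa_act_superset[OF *(1,3)] fa_act_superset[OF *(1,4)]
        lookup_add distrib_right sum.distrib)
qed

lemma fa_act_single: "fa_act (Poly_Mapping.single u c) f a = c * word_act u f a"
  by (simp add: fa_act_def)

lemma fa_act_zero: "fa_act 0 f a = 0"
  by (simp add: fa_act_def)

lemma fa_act_minus: "fa_act (- p) f a = - fa_act p f a"
  using fa_act_add[of p "- p" f a] by (simp add: fa_act_zero add_eq_0_iff)

lemma fa_act_diff: "fa_act (p - q) f a = fa_act p f a - fa_act q f a"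
  using fa_act_add[of p "- q" f a] by (simp add: fa_act_minus)

lemma fa_induct [case_names zero single add]:
  assumes "P 0" "\<And>u c. P (Poly_Mapping.single u c)" "\<And>p q. P p \<Longrightarrow> P q \<Longrightarrow> P (p + q)"
  shows "P (p :: 'u \<Rightarrow>\<^sub>0 'c::ab_group_add)"
proof (induction p rule: Poly_Mapping.update_induct)
  case const
  show ?case by (rule assms(1))
next
  case (update p u c)
  then have "Poly_Mapping.update u c p = p + Poly_Mapping.single u c"
    by (intro poly_mapping_eqI)
       (auto simp: lookup_update lookup_add lookup_single in_keys_iff when_def)
  then show ?case using update assms by simp
qed

lemma fa_act_fun_add: "fa_act p (\<lambda>a. f a + h a) = (\<lambda>a. fa_act p f a + fa_act p h a)"
  by (simp add: fa_act_def word_act_linear distrib_left sum.distrib)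

lemma fa_act_mult: "fa_act (p * q) f = fa_act p (fa_act q f)"
proof (induction p rule: fa_induct)
  case zero
  then show ?case by (simp add: fa_act_zero fun_eq_iff)
next
  case (single u c)
  show ?case
  proof (induction q rule: fa_induct)
    case zero
    have "word_act u (\<lambda>a. 0 * (0::'b)) = (\<lambda>a. 0)" by (subst word_act_linear) simp
    then show ?case by (auto simp: fun_eq_iff fa_act_zero fa_act_single fa_act_zero[abs_def])
  next
    case (single v d)
    have *: "fa_act (Poly_Mapping.single v d) f = (\<lambda>a. d * word_act v f a)"
      by (simp add: fun_eq_iff fa_act_single)
    show ?case
      by (simp add: fun_eq_iff mult_single fa_act_single * word_act_linear word_act_add)
  next
    case (add p q)
    have "fa_act (p + q) f = (\<lambda>a. fa_act p f a + fa_act q f a)"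
      by (simp add: fun_eq_iff fa_act_add)
    then show ?case using add by (simp add: fun_eq_iff distrib_left fa_act_add fa_act_fun_add)
  qed
next
  case (add p1 p2)
  then show ?case by (simp add: fun_eq_iff distrib_right fa_act_add)
qed

lemma fa_act_gen: "fa_act (fa_gen g) f = gen_act g f"
  by (simp add: fun_eq_iff fa_gen_def fa_act_single word_act_def)

lemma fa_act_one: "fa_act 1 f = f"
proof -
  have "word_act 0 f = f" by (simp add: word_act_def zero_free_monoid_def)
  then show ?thesis using fa_act_single[of 0 1 f] by (simp add: fun_eq_iff)
qed

lemma fa_act_relation:
  assumes "r \<in> weyl_relations"
  shows "fa_act r f a = 0"
  using assms
proof cases
  case (xx i j)
  then show ?thesis
    by (cases "i = j") (simp_all add: fa_act_diff fa_act_mult fa_act_gen fa_act_zero fun_upd_twist)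
next
  case (yy i j)
  then show ?thesis
    by (cases "i = j") (simp_all add: fa_act_diff fa_act_mult fa_act_gen fa_act_zero fun_upd_twist)
next
  case (yx i j)
  then show ?thesis
    by (cases "i = j")
       (auto simp: fa_act_diff fa_act_mult fa_act_gen fa_act_one fa_act_zero fun_upd_twist distrib_right left_diff_distrib)
qed

lemma fa_act_ideal:
  assumes "p \<in> two_sided_ideal weyl_relations"
  shows "fa_act p f a = 0"
  using assms
proof (induction arbitrary: f a)
  case zero
  then show ?case by (simp add: fa_act_zero)
next
  case (gen s b c)
  have "fa_act s (fa_act c f) = fa_act 0 (fa_act c f)"
    using fa_act_relation[OF gen] by (simp add: fun_eq_iff fa_act_zero)
  then have "fa_act (b * s * c) f = fa_act (b * 0) (fa_act c f)"
    by (simp only: fa_act_mult)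
  then show ?case by (simp add: fa_act_zero)
next
  case (add p q)
  then show ?case by (simp add: fa_act_add)
qed

lemma one_notin_weyl_ideal: "1 \<notin> two_sided_ideal weyl_relations"
proof
  assume "(1 :: ('a weyl_gen, 'b::field) free_algebra) \<in> two_sided_ideal weyl_relations"
  from fa_act_ideal[OF this, of "\<lambda>_. 1"] show False by (simp add: fa_act_one)
qed

subsection \<open>The quotient\<close>

quotient_type (overloaded) ('n, 'k) weyl_algebra = "('n weyl_gen, 'k::field) free_algebra" / weyl_rel
  by (rule equivp_weyl_rel)

instantiation weyl_algebra :: (type, field) ring_1
begin

lift_definition zero_weyl_algebra :: "('a, 'b) weyl_algebra" is 0 .
lift_definition one_weyl_algebra :: "('a, 'b) weyl_algebra" is 1 .

lift_definition plus_weyl_algebra :: "('a, 'b) weyl_algebra \<Rightarrow> ('a, 'b) weyl_algebra \<Rightarrow> ('a, 'b) weyl_algebra"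
  is "(+)"
  unfolding weyl_rel_def by (simp add: add_diff_add two_sided_ideal.add)

lift_definition minus_weyl_algebra :: "('a, 'b) weyl_algebra \<Rightarrow> ('a, 'b) weyl_algebra \<Rightarrow> ('a, 'b) weyl_algebra"
  is "(-)"
proof -
  fix p p' q q' :: "('a weyl_gen, 'b) free_algebra"
  assume "weyl_rel p p'" "weyl_rel q q'"
  then have "(p - p') - (q - q') \<in> two_sided_ideal weyl_relations"
    unfolding weyl_rel_def by (rule two_sided_ideal_diff)
  then show "weyl_rel (p - q) (p' - q')"
    by (simp add: weyl_rel_def algebra_simps)
qed

lift_definition uminus_weyl_algebra :: "('a, 'b) weyl_algebra \<Rightarrow> ('a, 'b) weyl_algebra" is uminus
  unfolding weyl_rel_def by (drule two_sided_ideal_minus) simp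

lift_definition times_weyl_algebra :: "('a, 'b) weyl_algebra \<Rightarrow> ('a, 'b) weyl_algebra \<Rightarrow> ('a, 'b) weyl_algebra"
  is "(*)"
proof -
  fix p p' q q' :: "('a weyl_gen, 'b) free_algebra"
  assume "weyl_rel p p'" "weyl_rel q q'"
  then have "1 * (p - p') * q + p' * (q - q') * 1 \<in> two_sided_ideal weyl_relations"
    unfolding weyl_rel_def by (intro two_sided_ideal.add two_sided_ideal_mult)
  then show "weyl_rel (p * q) (p' * q')"
    by (simp add: weyl_rel_def algebra_simps)
qed

instance
proof
  fix a b c :: "('a, 'b) weyl_algebra"
  note refl = equivp_reflp[OF equivp_weyl_rel]
  show "a + b + c = a + (b + c)" by transfer (simp add: add.assoc refl)
  show "a + b = b + a" by transfer (simp add: add.commute refl)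
  show "0 + a = a" by transfer (simp add: refl)
  show "- a + a = 0" by transfer (simp add: refl)
  show "a - b = a + - b" by transfer (simp add: refl)
  show "a * b * c = a * (b * c)" by transfer (simp add: mult.assoc refl)
  show "1 * a = a" by transfer (simp add: refl)
  show "a * 1 = a" by transfer (simp add: refl)
  show "(a + b) * c = a * c + b * c" by transfer (simp add: distrib_right refl)
  show "a * (b + c) = a * b + a * c" by transfer (simp add: distrib_left refl)
  show "(0 :: ('a, 'b) weyl_algebra) \<noteq> 1"
  proof
    assume "(0 :: ('a, 'b) weyl_algebra) = 1"
    then have "weyl_rel 1 (0 :: ('a weyl_gen, 'b) free_algebra)"
      by transfer (rule equivp_symp[OF equivp_weyl_rel])
    then show False by (simp add: weyl_rel_def one_notin_weyl_ideal)
  qed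
qed

end

lift_definition weyl_const :: "'k::field \<Rightarrow> ('n, 'k) weyl_algebra" is fa_const .


section \<open>Skewfields of fractions\<close>

text \<open>
  \<open>skewfield_of_fractions \<iota>\<close> says that the skewfield \<open>'d\<close>, together with the embedding \<open>\<iota>\<close>, is a skewfield
  of (right) fractions \<open>a s\<^sup>-\<^sup>1\<close> of the ring \<open>'a\<close>. This determines the pair \<open>('d, \<iota>)\<close> up to unique
  isomorphism. In a \<open>division_ring\<close>, \<open>x / y\<close> is \<open>x * inverse y\<close>.
\<close>

definition skewfield_of_fractions :: "('a::ring_1 \<Rightarrow> 'd::division_ring) \<Rightarrow> bool" where
  "skewfield_of_fractions \<iota> \<longleftrightarrow>
     \<iota> 1 = 1 \<and> (\<forall>a b. \<iota> (a + b) = \<iota> a + \<iota> b) \<and> (\<forall>a b. \<iota> (a * b) = \<iota> a * \<iota> b) \<and> inj \<iota> \<and>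
     (\<forall>d. \<exists>a s. s \<noteq> 0 \<and> d = \<iota> a / \<iota> s)"

end

theory Submission
  imports Defs
begin

text \<open>
  The extension of \<open>v\<close> is the Gauss valuation: every element of the Weyl algebra is a combination
  \<open>\<Sum> c\<^sub>a\<^sub>b x\<^sup>a y\<^sup>b\<close> of normally ordered monomials, and its value is the minimum of the \<open>v (c\<^sub>a\<^sub>b)\<close>. For this to work
  the element has to determine the coefficients and the minimum has to be multiplicative.

  The coefficients are read off from an action on commutative polynomials in \<open>x\<^sub>i, y\<^sub>i\<close>, with \<open>X\<^sub>i\<close> acting as
  multiplication by \<open>x\<^sub>i\<close> and \<open>Y\<^sub>i\<close> as \<open>y\<^sub>i + \<partial>/\<partial>x\<^sub>i\<close>. Unlike the action by \<open>\<partial>/\<partial>x\<^sub>i\<close> alone it is faithful in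
  every characteristic: the effect of an element on \<open>1\<close>, here called its symbol, is its normal form read
  as a commutative polynomial (\<open>normal_form_symbol\<close>).

  Multiplicativity is Gauss's lemma. Reordering a product of two normal monomials gives
  \<open>x\<^sup>a y\<^sup>b x\<^sup>c y\<^sup>d = x\<^sup>a\<^sup>+\<^sup>c y\<^sup>b\<^sup>+\<^sup>d + \<dots>\<close> where the remaining monomials are smaller in a fixed monomial order and have
  natural numbers as coefficients (\<open>leading_shift_normal_monomial\<close>); the latter matters because natural
  numbers have nonnegative value. In each factor take the largest monomial among those whose coefficient
  has minimal value. In the product, the coefficient at the product of these two monomials is the
  product of the two coefficients plus terms of strictly larger value, so it has exactly the
  expected value (\<open>gauss_product\<close>).

  Finally \<open>w (a s\<^sup>-\<^sup>1) = w a - w s\<close> extends any valuation from a ring to its skewfield of right fractions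
  (\<open>ring_valuation_extends_to_fractions\<close>).
\<close>

section \<open>Valuations on rings and their skewfields of fractions\<close>

lemma group_add_strict_mono:
  fixes a b c :: "'g::linordered_group_add"
  shows "a < b \<Longrightarrow> c + a < c + b" "a < b \<Longrightarrow> a + c < b + c"
  by (simp_all add: order_less_le add_left_mono_group add_right_mono_group)

lemma with_infty_add_infty [simp]:
  "\<infinity> + (x :: 'g::plus with_infty) = \<infinity>" "(x :: 'g::plus with_infty) + \<infinity> = \<infinity>"
  by (cases x; simp add: infinity_with_infty_def)+

lemma Fin_neq_infty [simp]: "Fin a \<noteq> \<infinity>" "\<infinity> \<noteq> Fin a"
  by (simp_all add: infinity_with_infty_def)

lemma with_infty_le_infty [simp]: "(x :: 'g::linorder with_infty) \<le> \<infinity>"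
  by (cases x) (simp_all add: less_eq_with_infty_def infinity_with_infty_def)

lemma Fin_le_Fin [simp]: "Fin a \<le> Fin b \<longleftrightarrow> a \<le> b"
  by (simp add: less_eq_with_infty_def)

lemma Fin_less_Fin [simp]: "Fin a < Fin b \<longleftrightarrow> a < b"
  by (simp add: less_with_infty_def less_le_not_le)

lemma not_infty_obtain:
  assumes "x \<noteq> \<infinity>" obtains a where "x = Fin a"
  using assms by (cases x) (auto simp: infinity_with_infty_def)

lemma with_infty_add_mono:
  fixes a b c d :: "'g::linordered_group_add with_infty"
  assumes "a \<le> b" "c \<le> d" shows "a + c \<le> b + d"
proof (cases "b = \<infinity> \<or> d = \<infinity>")
  case False
  then obtain b' d' where bd: "b = Fin b'" "d = Fin d'" by (metis not_infty_obtain)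
  then obtain a' c' where ac: "a = Fin a'" "c = Fin c'"
    using assms by (cases a; cases c) (auto simp: less_eq_with_infty_def)
  have "a' + c' \<le> a' + d'" "a' + d' \<le> b' + d'"
    using assms bd ac by (auto intro: add_left_mono_group add_right_mono_group)
  then show ?thesis using bd ac by simp
qed auto

lemma with_infty_add_strict_mono:
  fixes b d :: "'g::linordered_group_add with_infty"
  assumes "Fin a \<le> b" "Fin c \<le> d" "Fin a < b \<or> Fin c < d" shows "Fin (a + c) < b + d"
proof (cases "b = \<infinity> \<or> d = \<infinity>")
  case True
  then have "b + d = \<infinity>" by auto
  then show ?thesis by (simp add: order_less_le)
next
  case False
  then obtain b' d' where bd: "b = Fin b'" "d = Fin d'" by (metis not_infty_obtain)
  have "a + c \<le> a + d'" "a + d' \<le> b' + d'" "a + c < a + d' \<or> a + d' < b' + d'"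
    using assms bd by (auto intro: add_left_mono_group add_right_mono_group group_add_strict_mono)
  then show ?thesis using bd by force
qed

text \<open>
  The axioms of \<^const>\<open>valuation\<close> on a ring without division, so that they can be established for the
  Weyl algebra before passing to fractions.
\<close>

definition ring_valuation :: "('a::ring_1 \<Rightarrow> 'g::linordered_group_add with_infty) \<Rightarrow> bool" where
  "ring_valuation u \<longleftrightarrow>
     (\<forall>x. u x = \<infinity> \<longleftrightarrow> x = 0) \<and>
     (\<forall>x y. u (x * y) = u x + u y) \<and>
     (\<forall>x y. min (u x) (u y) \<le> u (x + y))"

lemma valuation_iff_ring_valuation: "valuation w \<longleftrightarrow> ring_valuation w"
  by (simp add: valuation_def ring_valuation_def)

context
  fixes u :: "'a::ring_1 \<Rightarrow> 'g::linordered_group_add with_infty"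
  assumes val: "ring_valuation u"
begin

lemma ring_valuation_eq_infty [simp]: "u x = \<infinity> \<longleftrightarrow> x = 0"
  using val by (simp add: ring_valuation_def)

lemma ring_valuation_zero: "u 0 = \<infinity>"
  by simp

lemma ring_valuation_mult: "u (x * y) = u x + u y"
  using val by (simp add: ring_valuation_def)

lemma ring_valuation_add: "min (u x) (u y) \<le> u (x + y)"
  using val by (simp add: ring_valuation_def)

lemma ring_valuation_finite:
  assumes "x \<noteq> 0" obtains a where "u x = Fin a"
  using assms not_infty_obtain[of "u x"] by auto

lemma ring_valuation_no_zero_divisors: "x * y = 0 \<Longrightarrow> x = 0 \<or> y = 0" for x y :: 'a
  using ring_valuation_mult[of x y] ring_valuation_eq_infty[of x] ring_valuation_eq_infty[of y]
    ring_valuation_eq_infty[of 0]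
  by (cases "u x"; cases "u y") (auto simp: infinity_with_infty_def)

lemma ring_valuation_one: "u 1 = Fin 0"
proof -
  obtain a where a: "u 1 = Fin a" using ring_valuation_finite[of 1] by auto
  then have "a + a = a" using ring_valuation_mult[of 1 1] by simp
  then have "a = 0" by (metis add.right_neutral add_left_cancel)
  then show ?thesis using a by simp
qed

text \<open>The value of \<open>-1\<close> is a torsion element, and a totally ordered group has no torsion.\<close>

lemma ring_valuation_minus: "u (- x) = u x"
proof -
  obtain a where a: "u (-1) = Fin a" using ring_valuation_finite[of "-1"] by auto
  then have aa: "a + a = 0"
    using ring_valuation_mult[of "-1" "-1"] ring_valuation_one by simp
  have "a = 0"
  proof (rule ccontr)
    assume "a \<noteq> 0"
    then have "a + a < a \<and> a < 0 \<or> a < a + a \<and> 0 < a"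
      using group_add_strict_mono(1)[of a 0 a] group_add_strict_mono(1)[of 0 a a]
      by (metis add.right_neutral neqE)
    then show False using aa by auto
  qed
  then show ?thesis
    using ring_valuation_mult[of "-1" x] a by (cases "u x") auto
qed

text \<open>
  The coefficients that arise when generators are reordered are natural numbers; this is all that
  has to be known about their values.
\<close>

lemma ring_valuation_of_nat_nonneg: "Fin 0 \<le> u (of_nat k)"
proof (induction k)
  case (Suc k)
  then show ?case
    using ring_valuation_add[of 1 "of_nat k"] by (auto simp: ring_valuation_one)
qed (simp add: ring_valuation_zero)

lemma ring_valuation_sum:
  assumes "\<And>i. i \<in> I \<Longrightarrow> \<gamma> \<le> u (f i)"
  shows "\<gamma> \<le> u (sum f I)"
  using assms
proof (induction I rule: infinite_finite_induct)
  case (insert i I)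
  then have "\<gamma> \<le> min (u (f i)) (u (sum f I))" by simp
  also have "\<dots> \<le> u (f i + sum f I)" by (rule ring_valuation_add)
  finally show ?case using insert by simp
qed (auto simp: ring_valuation_zero)

lemma ring_valuation_sum_strict:
  assumes "\<And>i. i \<in> I \<Longrightarrow> Fin \<gamma> < u (f i)"
  shows "Fin \<gamma> < u (sum f I)"
  using assms
proof (induction I rule: infinite_finite_induct)
  case (insert i I)
  then have "Fin \<gamma> < min (u (f i)) (u (sum f I))" by simp
  also have "\<dots> \<le> u (f i + sum f I)" by (rule ring_valuation_add)
  finally show ?case using insert by simp
qed (auto simp: ring_valuation_zero order_less_le)

text \<open>
  The value of \<open>x\<close> cannot exceed that of \<open>x + y\<close>, as \<open>x = (x + y) - y\<close> and \<open>y\<close> has too large a value to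
  attain the minimum.
\<close>

lemma ring_valuation_add_dominant:
  assumes "u x < u y" shows "u (x + y) = u x"
proof (rule antisym)
  have "min (u (x + y)) (u y) \<le> u x"
    using ring_valuation_add[of "x + y" "- y"] by (simp add: ring_valuation_minus)
  then show "u (x + y) \<le> u x" using assms by (auto simp: min_def split: if_splits)
  show "u x \<le> u (x + y)" using ring_valuation_add[of x y] assms by (simp add: min_absorb1)
qed

text \<open>
  Put \<open>w (a s\<^sup>-\<^sup>1) = u a - u s\<close>. The Ore condition is contained in the hypothesis that every element of
  the skewfield is a right fraction: writing \<open>s\<^sup>-\<^sup>1 b\<close> as a right fraction \<open>c t\<^sup>-\<^sup>1\<close> means \<open>b t = s c\<close>.
  This produces the common right denominators that are needed for well-definedness and for sums,
  and turns a product of fractions into one fraction. Common factors are cancelled on the right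
  throughout, which fits the order of the summands in \<open>u a - u s\<close> when the value group is noncommutative.
\<close>

lemma ring_valuation_extends_to_fractions:
  fixes \<iota> :: "'a \<Rightarrow> 'd::division_ring"
  assumes \<iota>: "skewfield_of_fractions \<iota>"
  shows "\<exists>w. valuation w \<and> (\<forall>a. w (\<iota> a) = u a)"
proof -
  have \<iota>1: "\<iota> 1 = 1" and \<iota>add: "\<And>a b. \<iota> (a + b) = \<iota> a + \<iota> b" and \<iota>mult: "\<And>a b. \<iota> (a * b) = \<iota> a * \<iota> b"
    and inj: "inj \<iota>" and frac: "\<And>d. \<exists>a s. s \<noteq> 0 \<and> d = \<iota> a / \<iota> s"
    using \<iota> unfolding skewfield_of_fractions_def by auto
  have \<iota>0: "\<iota> 0 = 0" using \<iota>add[of 0 0] by simp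
  have \<iota>eq0 [simp]: "\<iota> a = 0 \<longleftrightarrow> a = 0" for a using inj \<iota>0 by (metis injD)
  have \<iota>eq: "\<iota> a = \<iota> b \<longleftrightarrow> a = b" for a b using inj by (meson injD)
  define val where "val a = (case u a of Fin g \<Rightarrow> g | Infty \<Rightarrow> 0)" for a
  have u_val: "u a = Fin (val a)" if "a \<noteq> 0" for a
    using ring_valuation_eq_infty[of a] that by (cases "u a") (auto simp: val_def infinity_with_infty_def)
  have nz: "a * b \<noteq> 0" if "a \<noteq> 0" "b \<noteq> 0" for a b :: 'a
    using ring_valuation_no_zero_divisors that by blast
  have val_mult: "val (a * b) = val a + val b" if "a \<noteq> 0" "b \<noteq> 0" for a b
    using ring_valuation_mult[of a b] u_val nz that by simp
  have ore: "\<exists>c t. t \<noteq> 0 \<and> b * t = s * c" if "s \<noteq> 0" for b s :: 'a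
  proof -
    obtain c t where "t \<noteq> 0" "inverse (\<iota> s) * \<iota> b = \<iota> c / \<iota> t" using frac by blast
    then have "\<iota> s * (inverse (\<iota> s) * \<iota> b) * \<iota> t = \<iota> s * \<iota> c"
      by (simp add: divide_inverse mult.assoc)
    then have "\<iota> (b * t) = \<iota> (s * c)"
      using that by (simp add: \<iota>mult mult.assoc[symmetric])
    then show ?thesis using \<iota>eq \<open>t \<noteq> 0\<close> by blast
  qed
  \<comment> \<open>Right fractions may be enlarged on the right only; this is the single way of changing denominators.\<close>
  have expand: "\<iota> (a * c) / \<iota> (s * c) = \<iota> a / \<iota> s" if "s \<noteq> 0" "c \<noteq> 0" for a s c :: 'a
  proof -
    have "\<iota> (a * c) / \<iota> (s * c) = \<iota> a * (\<iota> c * inverse (\<iota> c)) * inverse (\<iota> s)"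
      using that by (simp only: \<iota>mult divide_inverse nonzero_inverse_mult_distrib \<iota>eq0 mult.assoc
          not_False_eq_True)
    then show ?thesis using that by (simp add: divide_inverse)
  qed
  have same_value: "val a - val s = val b - val t"
    if "s \<noteq> 0" "t \<noteq> 0" "a \<noteq> 0" "\<iota> a / \<iota> s = \<iota> b / \<iota> t" for a s b t
  proof -
    have "b \<noteq> 0" using that by (auto simp: divide_inverse \<iota>0)
    obtain c r where r: "r \<noteq> 0" "t * r = s * c" using ore[OF \<open>s \<noteq> 0\<close>] by metis
    have "c \<noteq> 0" using r nz[OF that(2)] by fastforce
    have "\<iota> (a * c) / \<iota> (s * c) = \<iota> (b * r) / \<iota> (t * r)"
      using expand[OF \<open>s \<noteq> 0\<close> \<open>c \<noteq> 0\<close>, of a] expand[OF \<open>t \<noteq> 0\<close> r(1), of b] that(4) by simp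
    then have "a * c = b * r"
      using r(2) nz[OF that(2) r(1)] \<iota>eq by (simp add: divide_inverse)
    then have "val a + val c = val b + val r" "val t + val r = val s + val c"
      using val_mult r that \<open>b \<noteq> 0\<close> \<open>c \<noteq> 0\<close> by metis+
    then have "(val a + val c) - (val s + val c) = (val b + val r) - (val t + val r)" by simp
    then show ?thesis 
      by (simp only: diff_conv_add_uminus minus_add add.assoc add_minus_cancel)
  qed
  define w where "w d = (if d = 0 then \<infinity> else
      Fin (let (a, s) = SOME (a, s). s \<noteq> 0 \<and> d = \<iota> a / \<iota> s in val a - val s))" for d
  have w0: "w d = \<infinity> \<longleftrightarrow> d = 0" for d by (simp add: w_def)
  have w_frac: "w (\<iota> a / \<iota> s) = Fin (val a - val s)" if "a \<noteq> 0" "s \<noteq> 0" for a s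
  proof -
    define p where "p = (SOME (b, t). t \<noteq> 0 \<and> \<iota> a / \<iota> s = \<iota> b / \<iota> t)"
    obtain b t where bt: "p = (b, t)" by (cases p)
    have "case p of (b, t) \<Rightarrow> t \<noteq> 0 \<and> \<iota> a / \<iota> s = \<iota> b / \<iota> t"
      unfolding p_def by (rule someI[of _ "(a, s)"]) (use that in simp)
    then have "t \<noteq> 0" "\<iota> a / \<iota> s = \<iota> b / \<iota> t" by (simp_all add: bt)
    then have "val a - val s = (let (b, t) = p in val b - val t)"
      using same_value[OF \<open>s \<noteq> 0\<close> _ \<open>a \<noteq> 0\<close>] by (simp add: bt)
    moreover have "\<iota> a / \<iota> s \<noteq> 0" using that by (simp add: divide_inverse)
    ultimately show ?thesis by (simp add: w_def p_def)
  qed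
  have w_mult: "w (x * y) = w x + w y" for x y
  proof (cases "x = 0 \<or> y = 0")
    case False
    obtain a s where as: "s \<noteq> 0" "x = \<iota> a / \<iota> s" using frac by blast
    obtain b t where bt: "t \<noteq> 0" "y = \<iota> b / \<iota> t" using frac by blast
    have ab: "a \<noteq> 0" "b \<noteq> 0" using False as bt by (auto simp: \<iota>0 divide_inverse)
    obtain c r where cr: "r \<noteq> 0" "b * r = s * c" using ore[OF as(1)] by metis
    have c: "c \<noteq> 0" using cr nz[OF ab(2)] by fastforce
    have "x * y = \<iota> a * (inverse (\<iota> s) * (\<iota> (b * r) / \<iota> (t * r)))"
      using expand[OF bt(1) cr(1)] as bt by (simp add: divide_inverse mult.assoc)
    also have "\<dots> = \<iota> a * ((inverse (\<iota> s) * \<iota> s) * (\<iota> c / \<iota> (t * r)))"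
      unfolding cr(2) \<iota>mult[of s c] by (simp only: divide_inverse mult.assoc)
    also have "\<dots> = \<iota> (a * c) / \<iota> (t * r)"
      using as(1) by (simp add: \<iota>mult[of a c] divide_inverse mult.assoc)
    finally have "w (x * y) = Fin (val a + val c - (val t + val r))"
      using w_frac nz ab c bt(1) cr(1) val_mult by simp
    moreover have "val b + val r = val s + val c"
      using cr val_mult as(1) ab c by metis
    then have "val c = - val s + (val b + val r)" by simp
    then have "val a + val c - (val t + val r) = (val a - val s) + (val b - val t)"
      by (simp only: diff_conv_add_uminus minus_add add.assoc add_minus_cancel)
    ultimately show ?thesis using w_frac ab as bt by simp
  qed (use w0[of 0] in auto)
  have w_add: "min (w x) (w y) \<le> w (x + y)" for x y
  proof (cases "x = 0 \<or> y = 0 \<or> x + y = 0")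
    case True
    then have "x = 0 \<or> y = 0 \<or> w (x + y) = \<infinity>" by (simp add: w0)
    then show ?thesis by (elim disjE) simp_all
  next
    case False
    obtain a s where as: "s \<noteq> 0" "x = \<iota> a / \<iota> s" using frac by blast
    obtain b t where bt: "t \<noteq> 0" "y = \<iota> b / \<iota> t" using frac by blast
    obtain c r where cr: "r \<noteq> 0" "t * r = s * c" using ore[OF as(1)] by metis
    have c: "c \<noteq> 0" using cr nz[OF bt(1)] by fastforce
    define m where "m = t * r"
    have m: "m \<noteq> 0" using nz[OF bt(1) cr(1)] by (simp add: m_def)
    have x: "x = \<iota> (a * c) / \<iota> m" and y: "y = \<iota> (b * r) / \<iota> m"
      using expand[OF as(1) c, of a] expand[OF bt(1) cr(1), of b] as bt cr by (simp_all add: m_def)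
    then have xy: "x + y = \<iota> (a * c + b * r) / \<iota> m"
      by (simp add: \<iota>add add_divide_distrib)
    have nonzero: "a * c \<noteq> 0" "b * r \<noteq> 0" "a * c + b * r \<noteq> 0" using False x y xy by (auto simp: \<iota>0 divide_inverse)
    have "min (val (a * c)) (val (b * r)) \<le> val (a * c + b * r)"
      using ring_valuation_add[of "a * c" "b * r"] nonzero by (auto simp: u_val min_def split: if_splits)
    then have "min (val (a * c) - val m) (val (b * r) - val m) \<le> val (a * c + b * r) - val m"
      using add_right_mono_group[of _ _ "- val m"]
      by (fastforce simp: min_le_iff_disj)
    then show ?thesis
      unfolding x y xy[unfolded x y] w_frac[OF nonzero(1) m] w_frac[OF nonzero(2) m] w_frac[OF nonzero(3) m]
      by (auto simp: min_def split: if_splits)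
  qed
  have "w (\<iota> a) = u a" for a
  proof (cases "a = 0")
    case False
    have "val 1 = 0" using u_val[of 1] ring_valuation_one by simp
    then show ?thesis using w_frac[OF False, of 1] False by (simp add: \<iota>1 u_val)
  qed (simp add: w0 \<iota>0 ring_valuation_zero)
  moreover have "valuation w" unfolding valuation_def using w0 w_mult w_add by simp
  ultimately show ?thesis by blast
qed

end

section \<open>The action of the Weyl algebra on polynomials\<close>

text \<open>
  The derivative, the action of the free algebra and the passage from polynomials to normal forms
  are all prescribed on monomials and extended additively.
\<close>

definition linear_extension :: "('u \<Rightarrow> 'c::zero \<Rightarrow> 'e::comm_monoid_add) \<Rightarrow> ('u \<Rightarrow>\<^sub>0 'c) \<Rightarrow> 'e" where
  "linear_extension h f = (\<Sum>u\<in>Poly_Mapping.keys f. h u (Poly_Mapping.lookup f u))"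

lemma linear_extension_zero [simp]: "linear_extension h 0 = 0"
  by (simp add: linear_extension_def)

context
  fixes h :: "'u \<Rightarrow> 'c::ab_group_add \<Rightarrow> 'e::ab_group_add"
  assumes additive: "\<And>u a b. h u (a + b) = h u a + h u b"
begin

lemma linear_extension_single: "linear_extension h (Poly_Mapping.single u c) = h u c"
  using additive[of u 0 0] by (simp add: linear_extension_def)

lemma linear_extension_add: "linear_extension h (f + g) = linear_extension h f + linear_extension h g"
proof -
  let ?A = "Poly_Mapping.keys f \<union> Poly_Mapping.keys g"
  have h0: "h u 0 = 0" for u using additive[of u 0 0] by simp
  have sup: "linear_extension h p = (\<Sum>u\<in>?A. h u (Poly_Mapping.lookup p u))"
    if "Poly_Mapping.keys p \<subseteq> ?A" for p
    unfolding linear_extension_def using that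
    by (intro sum.mono_neutral_left) (auto simp: in_keys_iff h0)
  show ?thesis
    by (simp add: sup Poly_Mapping.keys_add lookup_add additive sum.distrib)
qed

lemma linear_extension_diff: "linear_extension h (f - g) = linear_extension h f - linear_extension h g"
  using linear_extension_add[of "f - g" g] by simp

end

text \<open>Commutative polynomials in the symbols of the generators.\<close>

type_synonym ('n, 'k) symbol_poly = "('n weyl_gen \<Rightarrow>\<^sub>0 nat) \<Rightarrow>\<^sub>0 'k"

abbreviation unit_exp :: "'n weyl_gen \<Rightarrow> 'n weyl_gen \<Rightarrow>\<^sub>0 nat" where
  "unit_exp g \<equiv> Poly_Mapping.single g (Suc 0)"

abbreviation symbol_var :: "'n weyl_gen \<Rightarrow> ('n, 'k::field) symbol_poly" where
  "symbol_var g \<equiv> Poly_Mapping.single (unit_exp g) 1"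

abbreviation symbol_const :: "'k::field \<Rightarrow> ('n, 'k) symbol_poly" where
  "symbol_const c \<equiv> Poly_Mapping.single 0 c"

text \<open>The partial derivative with respect to \<open>x\<^sub>i\<close>.\<close>

definition deriv_X :: "'n \<Rightarrow> ('n, 'k::field) symbol_poly \<Rightarrow> ('n, 'k) symbol_poly" where
  "deriv_X i = linear_extension (\<lambda>m c.
     Poly_Mapping.single (m - unit_exp (X i)) (of_nat (Poly_Mapping.lookup m (X i)) * c))"

lemma deriv_X_single:
  "deriv_X i (Poly_Mapping.single m c) =
     Poly_Mapping.single (m - unit_exp (X i)) (of_nat (Poly_Mapping.lookup m (X i)) * c)"
  unfolding deriv_X_def by (rule linear_extension_single) (simp add: distrib_left single_add)

lemma deriv_X_zero [simp]: "deriv_X i 0 = 0"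
  by (simp add: deriv_X_def)

lemma deriv_X_add: "deriv_X i (f + g) = deriv_X i f + deriv_X i g"
  unfolding deriv_X_def by (rule linear_extension_add) (simp add: distrib_left single_add)

lemma deriv_X_const_mult: "deriv_X i (symbol_const c * f) = symbol_const c * deriv_X i f"
proof (induction f rule: fa_induct)
  case (single m d)
  then show ?case by (simp add: mult_single deriv_X_single ac_simps)
qed (simp_all add: distrib_left deriv_X_add)

text \<open>
  The Leibniz rule for a product with a variable. In the case \<open>g = X i\<close> the exponent of \<open>x\<^sub>i\<close> is
  positive unless the derivative vanishes, so truncated subtraction does no harm.
\<close>

lemma deriv_X_var_mult:
  "deriv_X i (symbol_var g * f) = symbol_var g * deriv_X i f + (if g = X i then f else 0)"
proof (induction f rule: fa_induct)
  case (single m c)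
  show ?case
  proof (cases "g = X i")
    case True
    show ?thesis
    proof (cases "Poly_Mapping.lookup m (X i) = 0")
      case False
      then have "unit_exp (X i) + (m - unit_exp (X i)) = m"
        by (intro poly_mapping_eqI) (auto simp: lookup_add lookup_minus lookup_single when_def)
      then show ?thesis using True
        by (simp add: mult_single deriv_X_single lookup_add single_add[symmetric] distrib_right add.commute)
    qed (use True in \<open>simp add: mult_single deriv_X_single lookup_add\<close>)
  next
    case False
    then have "unit_exp g + m - unit_exp (X i) = unit_exp g + (m - unit_exp (X i))"
      by (intro poly_mapping_eqI) (auto simp: lookup_add lookup_minus lookup_single when_def)
    then show ?thesis using False
      by (simp add: mult_single deriv_X_single lookup_add lookup_single_not_eq)
  qed
qed (simp_all add: distrib_left deriv_X_add)

lemma deriv_X_commute: "deriv_X i (deriv_X j f) = deriv_X j (deriv_X i f)"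
proof (induction f rule: fa_induct)
  case (single m c)
  have "m - unit_exp (X i) - unit_exp (X j) = m - unit_exp (X j) - unit_exp (X i)"
    by (simp add: diff_diff_add add.commute)
  then show ?case
    by (cases "i = j") (simp_all add: deriv_X_single lookup_minus lookup_single_not_eq ac_simps)
qed (simp_all add: deriv_X_add)

text \<open>
  The operators by which left multiplication by the generators acts on normal forms
  \<open>\<Sum> c x\<^sup>a y\<^sup>b\<close>, written as commutative polynomials: moving \<open>Y\<^sub>i\<close> to the right past \<open>x\<^sup>a\<close> costs a derivative.
  The summand \<open>y\<^sub>i f\<close> is what keeps the action faithful in characteristic \<open>p\<close>, where the \<open>p\<close>-th power of
  \<open>\<partial>\<^sub>i\<close> is zero.
\<close>

fun gen_op :: "'n weyl_gen \<Rightarrow> ('n, 'k::field) symbol_poly \<Rightarrow> ('n, 'k) symbol_poly" where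
  "gen_op (X i) f = symbol_var (X i) * f"
| "gen_op (Y i) f = symbol_var (Y i) * f + deriv_X i f"

lemma gen_op_add: "gen_op g (f + h) = gen_op g f + gen_op g h"
  by (cases g) (simp_all add: distrib_left deriv_X_add)

lemma gen_op_const_mult: "gen_op g (symbol_const c * f) = symbol_const c * gen_op g f"
  by (cases g) (simp_all add: distrib_left deriv_X_const_mult mult.left_commute)

definition word_op :: "'n weyl_gen free_monoid \<Rightarrow> ('n, 'k::field) symbol_poly \<Rightarrow> ('n, 'k) symbol_poly" where
  "word_op u = foldr gen_op (letters u)"

lemma word_op_plus: "word_op (u + v) f = word_op u (word_op v f)"
  by (simp add: word_op_def plus_free_monoid_def)

lemma word_op_add: "word_op u (f + h) = word_op u f + word_op u h"
proof -
  have "foldr gen_op us (f + h) = foldr gen_op us f + foldr gen_op us h" for us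
    by (induction us) (simp_all add: gen_op_add)
  then show ?thesis by (simp add: word_op_def)
qed

lemma word_op_const_mult: "word_op u (symbol_const c * f) = symbol_const c * word_op u f"
proof -
  have "foldr gen_op us (symbol_const c * f) = symbol_const c * foldr gen_op us f" for us
    by (induction us) (simp_all add: gen_op_const_mult)
  then show ?thesis by (simp add: word_op_def)
qed

definition fa_op ::
  "('n weyl_gen, 'k::field) free_algebra \<Rightarrow> ('n, 'k) symbol_poly \<Rightarrow> ('n, 'k) symbol_poly" where
  "fa_op p f = linear_extension (\<lambda>u c. symbol_const c * word_op u f) p"

lemma fa_op_single: "fa_op (Poly_Mapping.single u c) f = symbol_const c * word_op u f"
  unfolding fa_op_def by (rule linear_extension_single) (simp add: single_add distrib_right)

lemma fa_op_zero [simp]: "fa_op 0 f = 0"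
  by (simp add: fa_op_def)

lemma fa_op_add: "fa_op (p + q) f = fa_op p f + fa_op q f"
  unfolding fa_op_def by (rule linear_extension_add) (simp add: single_add distrib_right)

lemma fa_op_diff: "fa_op (p - q) f = fa_op p f - fa_op q f"
  unfolding fa_op_def by (rule linear_extension_diff) (simp add: single_add distrib_right)

lemma fa_op_add_right: "fa_op p (f + h) = fa_op p f + fa_op p h"
  by (simp add: fa_op_def linear_extension_def word_op_add distrib_left sum.distrib)

lemma fa_op_const_mult: "fa_op p (symbol_const c * f) = symbol_const c * fa_op p f"
  by (simp add: fa_op_def linear_extension_def word_op_const_mult sum_distrib_left mult.left_commute)

lemma fa_op_mult: "fa_op (p * q) f = fa_op p (fa_op q f)"
proof (induction p rule: fa_induct)
  case (single u c)
  show ?case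
  proof (induction q rule: fa_induct)
    case zero
    have "word_op u (0 :: ('a, 'b) symbol_poly) = 0" using word_op_add[of u 0 0] by simp
    then show ?case by (simp add: fa_op_single)
  next
    case (single v d)
    show ?case
      by (simp add: mult_single fa_op_single word_op_plus word_op_const_mult mult.assoc[symmetric])
  next
    case (add p q)
    then show ?case by (simp add: distrib_left fa_op_add fa_op_add_right)
  qed
qed (simp_all add: distrib_right fa_op_add)

lemma fa_op_gen: "fa_op (fa_gen g) f = gen_op g f"
  by (simp add: fa_gen_def fa_op_single word_op_def)

lemma fa_op_one: "fa_op 1 f = f"
proof -
  have "word_op 0 f = f" by (simp add: word_op_def zero_free_monoid_def)
  then show ?thesis using fa_op_single[of 0 1 f] by simp
qed

text \<open>
  The operators satisfy the defining relations. Only the cross relation uses more than commutativity: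
  it is the Leibniz rule \<open>\<partial>\<^sub>i (x\<^sub>j f) = x\<^sub>j \<partial>\<^sub>i f + \<delta>\<^sub>i\<^sub>j f\<close>.
\<close>

lemma fa_op_relation:
  assumes "r \<in> weyl_relations"
  shows "fa_op r f = 0"
  using assms
proof cases
  case (xx i j)
  then show ?thesis by (simp add: fa_op_diff fa_op_mult fa_op_gen mult.left_commute)
next
  case (yy i j)
  then show ?thesis
    by (simp add: fa_op_diff fa_op_mult fa_op_gen deriv_X_add deriv_X_var_mult distrib_left
        deriv_X_commute[of i j] mult.left_commute)
next
  case (yx i j)
  then show ?thesis
    by (cases "i = j")
      (simp_all add: fa_op_diff fa_op_mult fa_op_gen fa_op_one deriv_X_var_mult distrib_left mult.left_commute)
qed

lemma fa_op_ideal: "p \<in> two_sided_ideal weyl_relations \<Longrightarrow> fa_op p f = 0"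
proof (induction arbitrary: f rule: two_sided_ideal.induct)
  case (gen s a b)
  have "fa_op a 0 = 0" using fa_op_add_right[of a 0 0] by simp
  then show ?case using gen by (simp add: fa_op_mult fa_op_relation)
qed (simp_all add: fa_op_add)

lift_definition weyl_op :: "('n, 'k::field) weyl_algebra \<Rightarrow> ('n, 'k) symbol_poly \<Rightarrow> ('n, 'k) symbol_poly"
  is fa_op
proof
  fix p q :: "('n weyl_gen, 'k) free_algebra" and f
  assume "weyl_rel p q"
  then have "fa_op (p - q) f = 0" by (simp add: weyl_rel_def fa_op_ideal)
  then show "fa_op p f = fa_op q f" by (simp add: fa_op_diff)
qed

lift_definition weyl_generator :: "'n weyl_gen \<Rightarrow> ('n, 'k::field) weyl_algebra" is fa_gen .

lemma weyl_op_zero [simp]: "weyl_op 0 f = 0"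
  by transfer simp

lemma weyl_op_add: "weyl_op (a + b) f = weyl_op a f + weyl_op b f"
  by transfer (rule fa_op_add)

lemma weyl_op_mult: "weyl_op (a * b) f = weyl_op a (weyl_op b f)"
  by transfer (rule fa_op_mult)

lemma weyl_op_one: "weyl_op 1 f = f"
  by transfer (rule fa_op_one)

lemma weyl_op_generator: "weyl_op (weyl_generator g) f = gen_op g f"
  by transfer (rule fa_op_gen)

lemma weyl_op_const: "weyl_op (weyl_const c) f = symbol_const c * f"
  by transfer (simp add: fa_const_def fa_op_single word_op_def zero_free_monoid_def)

lemma weyl_op_add_right: "weyl_op a (f + h) = weyl_op a f + weyl_op a h"
  by transfer (rule fa_op_add_right)

lemma weyl_op_const_mult: "weyl_op a (symbol_const c * f) = symbol_const c * weyl_op a f"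
  by transfer (rule fa_op_const_mult)

lemma weyl_op_sum: "weyl_op (sum a I) f = (\<Sum>i\<in>I. weyl_op (a i) f)"
  by (induction I rule: infinite_finite_induct) (simp_all add: weyl_op_add)

lemma weyl_op_sum_right: "weyl_op a (sum f I) = (\<Sum>i\<in>I. weyl_op a (f i))"
proof (induction I rule: infinite_finite_induct)
  case (insert i I)
  then show ?case by (simp add: weyl_op_add_right)
qed (use weyl_op_add_right[of a 0 0] in simp_all)

section \<open>Normal forms in the Weyl algebra\<close>

lemma weyl_generator_X_commute:
  "weyl_generator (X i) * weyl_generator (X j) = weyl_generator (X j) * weyl_generator (X i)"
  by transfer (use two_sided_ideal.gen[OF weyl_relations.xx, of 1 _ _ 1] in \<open>simp add: weyl_rel_def\<close>)

lemma weyl_generator_Y_commute: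
  "weyl_generator (Y i) * weyl_generator (Y j) = weyl_generator (Y j) * weyl_generator (Y i)"
  by transfer (use two_sided_ideal.gen[OF weyl_relations.yy, of 1 _ _ 1] in \<open>simp add: weyl_rel_def\<close>)

lemma weyl_generator_Y_X:
  "weyl_generator (Y i) * weyl_generator (X j) =
     weyl_generator (X j) * weyl_generator (Y i) + (if i = j then 1 else 0)"
  apply transfer
  subgoal for i j
    using two_sided_ideal.gen[OF weyl_relations.yx[of i j], of 1 1]
    by (simp add: weyl_rel_def diff_diff_eq)
  done

lemma weyl_const_commute: "a * weyl_const c = weyl_const c * a"
proof transfer
  fix p :: "('a weyl_gen, 'b) free_algebra" and c :: 'b
  have "p * fa_const c = fa_const c * p"
    by (induction p rule: fa_induct) (simp_all add: fa_const_def mult_single distrib_left distrib_right mult.commute)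
  then show "weyl_rel (p * fa_const c) (fa_const c * p)"
    by (simp add: equivp_reflp[OF equivp_weyl_rel])
qed

lemma weyl_const_add: "weyl_const (c + d) = weyl_const c + weyl_const d"
  by transfer (simp add: fa_const_def single_add equivp_reflp[OF equivp_weyl_rel])

lemma weyl_const_mult: "weyl_const (c * d) = weyl_const c * weyl_const d"
  by transfer (simp add: fa_const_def mult_single equivp_reflp[OF equivp_weyl_rel])

lemma weyl_const_one [simp]: "weyl_const 1 = 1"
  by transfer (simp add: fa_const_def equivp_reflp[OF equivp_weyl_rel])

lemma weyl_const_zero [simp]: "weyl_const 0 = 0"
  by transfer (simp add: fa_const_def equivp_reflp[OF equivp_weyl_rel])

lemma weyl_const_of_nat: "weyl_const (of_nat k) = of_nat k"
  by (induction k) (simp_all add: weyl_const_add)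

definition prod_powers :: "('i \<Rightarrow> 'a::monoid_mult) \<Rightarrow> ('i \<Rightarrow> nat) \<Rightarrow> 'i list \<Rightarrow> 'a" where
  "prod_powers h k xs = prod_list (map (\<lambda>i. h i ^ k i) xs)"

lemma prod_powers_simps [simp]:
  "prod_powers h k [] = 1"
  "prod_powers h k (x # xs) = h x ^ k x * prod_powers h k xs"
  by (simp_all add: prod_powers_def)

lemma prod_powers_zero [simp]: "prod_powers h (\<lambda>_. 0) xs = 1"
  by (induction xs) simp_all

lemma prod_powers_cong:
  "(\<And>i. i \<in> set xs \<Longrightarrow> k i = l i) \<Longrightarrow> prod_powers h k xs = prod_powers h l xs"
  by (induction xs) auto

lemma prod_powers_absorb:
  assumes "\<And>i j. h i * h j = h j * h i" "distinct xs" "j \<in> set xs"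
  shows "h j * prod_powers h k xs = prod_powers h (k(j := Suc (k j))) xs"
  using assms(2,3)
proof (induction xs)
  case (Cons x xs)
  show ?case
  proof (cases "x = j")
    case True
    then have "prod_powers h k xs = prod_powers h (k(j := Suc (k j))) xs"
      using Cons.prems by (intro prod_powers_cong) auto
    then show ?thesis using True by (simp add: mult.assoc fun_upd_def)
  next
    case False
    have "h j * h x ^ k x = h x ^ k x * h j"
      using power_commuting_commutes[OF assms(1)] by metis
    then have "h j * prod_powers h k (x # xs) = h x ^ k x * (h j * prod_powers h k xs)"
      by (simp add: mult.assoc[symmetric])
    then show ?thesis using Cons False by simp
  qed
qed simp

text \<open>
  Commuting past \<open>x\<close> with \<open>[y, x] = 1\<close> differentiates; the term with \<open>k = 0\<close> vanishes because of the factor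
  \<open>of_nat k\<close>.
\<close>

lemma canonical_commutator_power:
  fixes x y :: "'a::ring_1"
  assumes "y * x = x * y + 1"
  shows "y * x ^ k = x ^ k * y + of_nat k * x ^ (k - 1)"
proof (induction k)
  case (Suc k)
  have "y * x ^ Suc k = x * (y * x ^ k) + x ^ k"
    by (simp add: mult.assoc[symmetric] assms distrib_right)
  also have "\<dots> = x ^ Suc k * y + of_nat k * (x * x ^ (k - 1)) + x ^ k"
    by (simp add: Suc distrib_left mult.assoc mult_of_nat_commute[of k x, symmetric]
        mult.assoc[symmetric, of x "of_nat k"])
  also have "of_nat k * (x * x ^ (k - 1)) = of_nat k * x ^ k"
    by (cases k) simp_all
  finally show ?case by (simp add: distrib_right add.assoc add.commute)
qed simp

lemma canonical_commutator_prod_powers: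
  fixes h :: "'i \<Rightarrow> 'a::ring_1"
  assumes "\<And>i. y * h i = h i * y + (if i = j then 1 else 0)" "distinct xs"
  shows "y * prod_powers h k xs = prod_powers h k xs * y +
           (if j \<in> set xs then of_nat (k j) * prod_powers h (k(j := k j - 1)) xs else 0)"
  using assms(2)
proof (induction xs)
  case (Cons x xs)
  have same: "prod_powers h (k(j := k j - 1)) xs = prod_powers h k xs" if "j \<notin> set xs"
    using that by (intro prod_powers_cong) auto
  show ?case
  proof (cases "x = j")
    case True
    have j: "y * h j ^ k j = h j ^ k j * y + of_nat (k j) * h j ^ (k j - 1)"
      using assms(1)[of j] by (intro canonical_commutator_power) simp
    have "y * prod_powers h k (x # xs) =
        h j ^ k j * (y * prod_powers h k xs) + of_nat (k j) * h j ^ (k j - 1) * prod_powers h k xs"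
      using True j by (simp add: mult.assoc[symmetric] distrib_right)
    then show ?thesis using Cons True same by (simp add: mult.assoc)
  next
    case False
    have "h x * y = y * h x" using assms(1)[of x] False by simp
    then have "y * h x ^ k x = h x ^ k x * y" by (metis power_commuting_commutes)
    then have "y * prod_powers h k (x # xs) = h x ^ k x * (y * prod_powers h k xs)"
      by (simp add: mult.assoc[symmetric])
    then show ?thesis
      using Cons False by (simp add: distrib_left mult.assoc mult_of_nat_commute[symmetric])
        (metis mult.assoc mult_of_nat_commute)
  qed
qed simp

text \<open>
  The order of the enumeration is immaterial, since it only arranges the \<open>X\<^sub>i\<close> among themselves and the
  \<open>Y\<^sub>i\<close> among themselves.
\<close>

definition enum_list :: "'n::finite list" where
  "enum_list = (SOME xs. set xs = UNIV \<and> distinct xs)"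

lemma set_enum_list [simp]: "set (enum_list :: 'n::finite list) = UNIV"
  and distinct_enum_list [simp]: "distinct (enum_list :: 'n list)"
proof -
  have "\<exists>xs. set xs = (UNIV :: 'n set) \<and> distinct xs"
    by (rule finite_distinct_list) simp
  from someI_ex[OF this]
  show "set (enum_list :: 'n list) = UNIV" "distinct (enum_list :: 'n list)"
    unfolding enum_list_def by auto
qed

definition normal_monomial :: "('n::finite weyl_gen \<Rightarrow>\<^sub>0 nat) \<Rightarrow> ('n, 'k::field) weyl_algebra" where
  "normal_monomial m =
     prod_powers (\<lambda>i. weyl_generator (X i)) (\<lambda>i. Poly_Mapping.lookup m (X i)) enum_list *
     prod_powers (\<lambda>i. weyl_generator (Y i)) (\<lambda>i. Poly_Mapping.lookup m (Y i)) enum_list"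

lemma X_normal_monomial:
  "weyl_generator (X j) * (normal_monomial m :: ('n::finite, 'k::field) weyl_algebra) = normal_monomial (unit_exp (X j) + m)"
proof -
  let ?x = "\<lambda>i. Poly_Mapping.lookup m (X i)" and ?y = "\<lambda>i. Poly_Mapping.lookup m (Y i)"
  let ?PX = "\<lambda>k. prod_powers (\<lambda>i. weyl_generator (X i) :: ('n, 'k) weyl_algebra) k enum_list"
  let ?PY = "\<lambda>k. prod_powers (\<lambda>i. weyl_generator (Y i) :: ('n, 'k) weyl_algebra) k enum_list"
  have "?x(j := Suc (?x j)) = (\<lambda>i. Poly_Mapping.lookup (unit_exp (X j) + m) (X i))"
    "?y = (\<lambda>i. Poly_Mapping.lookup (unit_exp (X j) + m) (Y i))"
    by (auto simp: lookup_add lookup_single when_def)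
  then have Xm: "normal_monomial (unit_exp (X j) + m) = ?PX (?x(j := Suc (?x j))) * ?PY ?y"
    by (simp only: normal_monomial_def)
  have "weyl_generator (X j) * ?PX ?x = ?PX (?x(j := Suc (?x j)))"
    by (intro prod_powers_absorb weyl_generator_X_commute) auto
  then show ?thesis
    unfolding Xm by (simp only: normal_monomial_def mult.assoc[symmetric])
qed

lemma Y_normal_monomial:
  "weyl_generator (Y j) * (normal_monomial m :: ('n::finite, 'k::field) weyl_algebra) = normal_monomial (unit_exp (Y j) + m) +
     of_nat (Poly_Mapping.lookup m (X j)) * normal_monomial (m - unit_exp (X j))"
proof -
  let ?x = "\<lambda>i. Poly_Mapping.lookup m (X i)" and ?y = "\<lambda>i. Poly_Mapping.lookup m (Y i)"
  let ?PX = "\<lambda>k. prod_powers (\<lambda>i. weyl_generator (X i) :: ('n, 'k) weyl_algebra) k enum_list"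
  let ?PY = "\<lambda>k. prod_powers (\<lambda>i. weyl_generator (Y i) :: ('n, 'k) weyl_algebra) k enum_list"
  have "?y(j := Suc (?y j)) = (\<lambda>i. Poly_Mapping.lookup (unit_exp (Y j) + m) (Y i))"
    "?x = (\<lambda>i. Poly_Mapping.lookup (unit_exp (Y j) + m) (X i))"
    by (auto simp: lookup_add lookup_single when_def)
  then have Ym: "normal_monomial (unit_exp (Y j) + m) = ?PX ?x * ?PY (?y(j := Suc (?y j)))"
    by (simp add: normal_monomial_def)
  have "?x(j := ?x j - 1) = (\<lambda>i. Poly_Mapping.lookup (m - unit_exp (X j)) (X i))"
    "?y = (\<lambda>i. Poly_Mapping.lookup (m - unit_exp (X j)) (Y i))"
    by (auto simp: lookup_minus lookup_single when_def)
  then have Xm: "normal_monomial (m - unit_exp (X j)) = ?PX (?x(j := ?x j - 1)) * ?PY ?y"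
    by (simp only: normal_monomial_def)
  have past: "weyl_generator (Y j) * ?PX ?x =
      ?PX ?x * weyl_generator (Y j) + of_nat (?x j) * ?PX (?x(j := ?x j - 1))"
    using canonical_commutator_prod_powers[of "weyl_generator (Y j)" "\<lambda>i. weyl_generator (X i)" j enum_list ?x]
    by (simp add: weyl_generator_Y_X eq_commute)
  have absorb: "weyl_generator (Y j) * ?PY ?y = ?PY (?y(j := Suc (?y j)))"
    by (intro prod_powers_absorb weyl_generator_Y_commute) auto
  have "weyl_generator (Y j) * (?PX ?x * ?PY ?y) = (weyl_generator (Y j) * ?PX ?x) * ?PY ?y"
    by (simp only: mult.assoc)
  also have "\<dots> = ?PX ?x * ?PY (?y(j := Suc (?y j))) + of_nat (?x j) * (?PX (?x(j := ?x j - 1)) * ?PY ?y)"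
    by (simp only: past distrib_right mult.assoc absorb)
  finally show ?thesis
    unfolding Ym Xm by (simp only: normal_monomial_def)
qed

definition normal_form :: "('n::finite, 'k::field) symbol_poly \<Rightarrow> ('n, 'k) weyl_algebra" where
  "normal_form = linear_extension (\<lambda>m c. weyl_const c * normal_monomial m)"

lemma normal_form_zero [simp]: "normal_form 0 = 0"
  by (simp add: normal_form_def)

lemma normal_form_single: "normal_form (Poly_Mapping.single m c) = weyl_const c * normal_monomial m"
  unfolding normal_form_def by (rule linear_extension_single) (simp add: weyl_const_add distrib_right)

lemma normal_form_add: "normal_form (f + g) = normal_form f + normal_form g"
  unfolding normal_form_def by (rule linear_extension_add) (simp add: weyl_const_add distrib_right)

lemma normal_form_const_mult: "normal_form (symbol_const c * f) = weyl_const c * normal_form f"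
  by (induction f rule: fa_induct)
    (simp_all add: mult_single normal_form_single normal_form_add distrib_left weyl_const_mult mult.assoc)

text \<open>
  \<^const>\<open>gen_op\<close> is the formula for left multiplication of normal monomials by a generator, so this reduces
  to \<open>X_normal_monomial\<close> and \<open>Y_normal_monomial\<close>.
\<close>

lemma normal_form_gen_op: "normal_form (gen_op g f) = weyl_generator g * normal_form f"
proof (induction f rule: fa_induct)
  case zero
  then show ?case by (cases g) simp_all
next
  case (single m c)
  have gc: "weyl_generator g * (weyl_const c * a) = weyl_const c * (weyl_generator g * a)" for a
    by (simp add: mult.assoc[symmetric] weyl_const_commute)
  show ?case
  proof (cases g)
    case (X i)
    then show ?thesis using gc by (simp add: mult_single normal_form_single X_normal_monomial)
  next
    case (Y i)
    have "weyl_const (of_nat k * c) * a = weyl_const c * (of_nat k * a)" for k and a :: "('a, 'b) weyl_algebra"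
      by (simp add: mult.commute[of "of_nat k" c] weyl_const_mult weyl_const_of_nat mult.assoc)
    then show ?thesis using gc Y
      by (simp add: mult_single deriv_X_single normal_form_add normal_form_single Y_normal_monomial distrib_left)
  qed
next
  case (add p q)
  then show ?case by (simp add: gen_op_add normal_form_add distrib_left)
qed

text \<open>
  Reading a polynomial as a normal form intertwines the action with left multiplication, because it
  does so for each generator. Applied to the polynomial \<open>1\<close> it recovers an element of the Weyl algebra
  from its effect on \<open>1\<close>: the normal monomials span, and no nonzero element kills \<open>1\<close>.
\<close>

lemma normal_form_weyl_op: "normal_form (weyl_op a f) = a * normal_form f"
proof -
  have "\<exists>p. a = abs_weyl_algebra p" by (induct a rule: weyl_algebra.abs_induct) blast
  then obtain p where p: "a = abs_weyl_algebra p" ..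
  have word: "normal_form (word_op (FM us) f) = abs_weyl_algebra (Poly_Mapping.single (FM us) 1) * normal_form f"
    for us
  proof (induction us)
    case Nil
    have "Poly_Mapping.single (FM []) 1 = (1 :: ('a weyl_gen, 'b) free_algebra)"
      by (simp add: zero_free_monoid_def[symmetric])
    then show ?case by (simp add: word_op_def one_weyl_algebra.abs_eq[symmetric])
  next
    case (Cons g us)
    have "Poly_Mapping.single (FM (g # us)) 1 = fa_gen g * (Poly_Mapping.single (FM us) 1 :: ('a weyl_gen, 'b) free_algebra)"
      by (simp add: fa_gen_def mult_single plus_free_monoid_def)
    then show ?case using Cons
      by (simp add: word_op_def normal_form_gen_op times_weyl_algebra.abs_eq[symmetric]
          weyl_generator.abs_eq[symmetric] mult.assoc)
  qed
  have "normal_form (fa_op p f) = abs_weyl_algebra p * normal_form f"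
  proof (induction p rule: fa_induct)
    case zero
    then show ?case by (simp add: zero_weyl_algebra.abs_eq[symmetric])
  next
    case (single u c)
    have "Poly_Mapping.single u c = fa_const c * (Poly_Mapping.single u 1 :: ('a weyl_gen, 'b) free_algebra)"
      by (simp add: fa_const_def mult_single)
    then have "abs_weyl_algebra (Poly_Mapping.single u c) =
        weyl_const c * abs_weyl_algebra (Poly_Mapping.single u 1 :: ('a weyl_gen, 'b) free_algebra)"
      by (simp only: times_weyl_algebra.abs_eq weyl_const.abs_eq)
    then show ?case using word[of "letters u"]
      by (simp add: fa_op_single normal_form_const_mult mult.assoc)
  next
    case (add p q)
    then show ?case
      by (simp add: fa_op_add normal_form_add plus_weyl_algebra.abs_eq[symmetric] distrib_right)
  qed
  then show ?thesis by (simp add: p weyl_op.abs_eq)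
qed

definition symbol :: "('n, 'k::field) weyl_algebra \<Rightarrow> ('n, 'k) symbol_poly" where
  "symbol a = weyl_op a 1"

lemma normal_form_symbol: "normal_form (symbol a) = a"
proof -
  have "normal_form (1 :: ('a, 'b) symbol_poly) = 1"
    using normal_form_single[of 0 1] by (simp add: normal_monomial_def)
  then show ?thesis by (simp add: symbol_def normal_form_weyl_op)
qed

lemma sum_single_lookup: "(\<Sum>m\<in>Poly_Mapping.keys f. Poly_Mapping.single m (Poly_Mapping.lookup f m)) = f"
  by (rule poly_mapping_eqI) (simp add: lookup_sum lookup_single when_def in_keys_iff)

text \<open>
  Symbols multiply by expanding the left factor into normal monomials and letting them act on the
  monomials of the right factor; the constants move to the front as they are central.
\<close>

lemma symbol_mult:
  fixes a b :: "('n::finite, 'k::field) weyl_algebra"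
  shows "symbol (a * b) = (\<Sum>m\<in>Poly_Mapping.keys (symbol a). \<Sum>n\<in>Poly_Mapping.keys (symbol b).
    symbol_const (Poly_Mapping.lookup (symbol a) m * Poly_Mapping.lookup (symbol b) n) *
      weyl_op (normal_monomial m) (Poly_Mapping.single n 1))"
proof -
  have scalars: "weyl_op (weyl_const c * normal_monomial m) (Poly_Mapping.single n d) =
      symbol_const (c * d) * weyl_op (normal_monomial m) (Poly_Mapping.single n 1)"
    for c d :: 'k and m n :: "'n weyl_gen \<Rightarrow>\<^sub>0 nat"
  proof -
    have "Poly_Mapping.single n d = symbol_const d * Poly_Mapping.single n 1" by (simp add: mult_single)
    then have "weyl_op (weyl_const c * normal_monomial m) (Poly_Mapping.single n d) =
        symbol_const d * (symbol_const c * weyl_op (normal_monomial m) (Poly_Mapping.single n 1))"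
      by (simp only: weyl_op_mult weyl_op_const weyl_op_const_mult)
    then show ?thesis by (simp add: mult.assoc[symmetric] mult_single mult.commute[of d c])
  qed
  have a: "a = (\<Sum>m\<in>Poly_Mapping.keys (symbol a). weyl_const (Poly_Mapping.lookup (symbol a) m) * normal_monomial m)"
    by (subst normal_form_symbol[of a, symmetric]) (simp add: normal_form_def linear_extension_def)
  have "symbol (a * b) = weyl_op a (symbol b)"
    by (simp add: symbol_def weyl_op_mult)
  also have "\<dots> = (\<Sum>m\<in>Poly_Mapping.keys (symbol a).
      weyl_op (weyl_const (Poly_Mapping.lookup (symbol a) m) * normal_monomial m) (symbol b))"
    by (subst a) (rule weyl_op_sum)
  also have "\<dots> = (\<Sum>m\<in>Poly_Mapping.keys (symbol a). \<Sum>n\<in>Poly_Mapping.keys (symbol b).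
      weyl_op (weyl_const (Poly_Mapping.lookup (symbol a) m) * normal_monomial m)
        (Poly_Mapping.single n (Poly_Mapping.lookup (symbol b) n)))"
    by (simp only: weyl_op_sum_right[symmetric] sum_single_lookup)
  finally show ?thesis by (simp only: scalars)
qed

section \<open>Leading terms of products of normal monomials\<close>

instance weyl_gen :: (finite) finite
proof
  have "x \<in> range X \<union> range Y" for x :: "'a weyl_gen" by (cases x) auto
  then have "UNIV = range X \<union> range (Y :: 'a \<Rightarrow> 'a weyl_gen)" by auto
  then show "finite (UNIV :: 'a weyl_gen set)" by (metis finite_UnI finite finite_imageI)
qed

text \<open>
  Gauss's lemma needs a total order on exponents that is compatible with addition. The index type
  carries no order, so the generators are numbered and exponents are compared
  through this additive embedding, whose target is ordered lexicographically.
\<close>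

definition lex_exp :: "('n::finite weyl_gen \<Rightarrow>\<^sub>0 nat) \<Rightarrow> nat \<Rightarrow>\<^sub>0 nat" where
  "lex_exp m = (\<Sum>g\<in>UNIV. Poly_Mapping.single (to_nat g) (Poly_Mapping.lookup m g))"

lemma lex_exp_add: "lex_exp (m + n) = lex_exp m + lex_exp n"
  by (simp add: lex_exp_def lookup_add single_add sum.distrib)

lemma lex_exp_inject: "lex_exp m = lex_exp n \<longleftrightarrow> m = n"
proof -
  have "Poly_Mapping.lookup (lex_exp m) (to_nat h) = Poly_Mapping.lookup m h" for m :: "'n::finite weyl_gen \<Rightarrow>\<^sub>0 nat" and h
    by (simp add: lex_exp_def lookup_sum lookup_single when_def)
  then show ?thesis by (metis poly_mapping_eqI)
qed

lemma poly_mapping_nat_nonneg: "0 \<le> (x :: nat \<Rightarrow>\<^sub>0 nat)"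
proof -
  have "\<not> x < 0" by transfer (simp add: less_fun_def)
  then show ?thesis by simp
qed

lemma lex_exp_nonneg: "0 \<le> lex_exp m"
  by (rule poly_mapping_nat_nonneg)

lemma lex_exp_unit_pos: "0 < lex_exp (unit_exp g)"
proof -
  have "lex_exp 0 = 0" by (simp add: lex_exp_def)
  then have "lex_exp (unit_exp g) \<noteq> 0"
    using lex_exp_inject[of "unit_exp g" 0] by (metis lookup_single_eq lookup_zero old.nat.distinct(2))
  then show ?thesis using lex_exp_nonneg[of "unit_exp g"] by simp
qed

lemma lex_exp_minus_unit: "lex_exp (m - unit_exp g) \<le> lex_exp m"
proof -
  have "m = (m - unit_exp g) + (m - (m - unit_exp g))"
    by (intro poly_mapping_eqI) (simp add: lookup_add lookup_minus)
  then have "lex_exp m = lex_exp (m - unit_exp g) + lex_exp (m - (m - unit_exp g))"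
    by (metis lex_exp_add)
  then show ?thesis
    using add_left_mono[OF lex_exp_nonneg[of "m - (m - unit_exp g)"], of "lex_exp (m - unit_exp g)"] by simp
qed

text \<open>
  Sums of strictly smaller monomials with natural numbers as coefficients. The coefficients are
  restricted in this way because it makes their values nonnegative for every valuation.
\<close>

inductive_set lower_poly :: "('n::finite weyl_gen \<Rightarrow>\<^sub>0 nat) \<Rightarrow> ('n, 'k::field) symbol_poly set" for m where
  zero: "0 \<in> lower_poly m"
| add: "lex_exp n < lex_exp m \<Longrightarrow> r \<in> lower_poly m \<Longrightarrow> Poly_Mapping.single n (of_nat k) + r \<in> lower_poly m"

lemma lower_poly_single: "lex_exp n < lex_exp m \<Longrightarrow> Poly_Mapping.single n (of_nat k) \<in> lower_poly m"
  using lower_poly.add[OF _ lower_poly.zero, of n m k] by simp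

lemma lower_poly_add: "r \<in> lower_poly m \<Longrightarrow> s \<in> lower_poly m \<Longrightarrow> r + s \<in> lower_poly m"
  by (induction rule: lower_poly.induct) (auto simp: add.assoc intro: lower_poly.add)

lemma lower_poly_lookup_eq_0:
  "r \<in> lower_poly m \<Longrightarrow> \<not> lex_exp n < lex_exp m \<Longrightarrow> Poly_Mapping.lookup r n = 0"
  by (induction rule: lower_poly.induct) (auto simp: lookup_add lookup_single when_def)

lemma lower_poly_lookup_of_nat: "r \<in> lower_poly m \<Longrightarrow> \<exists>k. Poly_Mapping.lookup r n = of_nat k"
proof (induction rule: lower_poly.induct)
  case (add n' r k)
  then obtain j where "Poly_Mapping.lookup r n = of_nat j" by blast
  then have "Poly_Mapping.lookup (Poly_Mapping.single n' (of_nat k) + r) n = of_nat ((if n' = n then k else 0) + j)"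
    by (simp add: lookup_add lookup_single when_def)
  then show ?case by blast
qed (auto intro: exI[of _ 0])

lemma gen_op_single_lower:
  assumes "lex_exp n < lex_exp m"
  shows "gen_op g (Poly_Mapping.single n (of_nat k :: 'k::field)) \<in> lower_poly (unit_exp g + m)"
proof -
  have less: "lex_exp (unit_exp g + n) < lex_exp (unit_exp g + m)"
    using assms by (simp add: lex_exp_add)
  show ?thesis
  proof (cases g)
    case (X i)
    then show ?thesis using less by (simp add: mult_single lower_poly_single)
  next
    case (Y i)
    \<comment> \<open>The derivative lowers the exponent, while the product with \<open>y\<^sub>i\<close> raises it.\<close>
    have "lex_exp (n - unit_exp (X i)) < lex_exp (unit_exp g + m)"
      using lex_exp_minus_unit[of n "X i"] assms lex_exp_unit_pos[of g]
      by (metis add_strict_mono add_0 lex_exp_add le_less_trans)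
    then have "Poly_Mapping.single (n - unit_exp (X i)) (of_nat (Poly_Mapping.lookup n (X i) * k) :: 'k)
        \<in> lower_poly (unit_exp g + m)"
      by (rule lower_poly_single)
    then show ?thesis using Y less
      by (simp add: mult_single deriv_X_single lower_poly_single lower_poly_add)
  qed
qed

lemma gen_op_lower: "r \<in> lower_poly m \<Longrightarrow> gen_op g r \<in> lower_poly (unit_exp g + m)"
proof (induction rule: lower_poly.induct)
  case zero
  then show ?case by (cases g) (simp_all add: lower_poly.zero)
qed (simp add: gen_op_add gen_op_single_lower lower_poly_add)

definition monic_poly :: "('n::finite weyl_gen \<Rightarrow>\<^sub>0 nat) \<Rightarrow> ('n, 'k::field) symbol_poly set" where
  "monic_poly m = {f. f - Poly_Mapping.single m 1 \<in> lower_poly m}"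

lemma gen_op_monic:
  assumes "f \<in> monic_poly m"
  shows "gen_op g f \<in> monic_poly (unit_exp g + m)"
proof -
  define r where "r = f - Poly_Mapping.single m 1"
  have r: "r \<in> lower_poly m" and f: "f = Poly_Mapping.single m 1 + r"
    using assms by (simp_all add: monic_poly_def r_def)
  have "gen_op g (Poly_Mapping.single m 1) - Poly_Mapping.single (unit_exp g + m) 1
      \<in> lower_poly (unit_exp g + m)"
  proof (cases g)
    case (X i)
    then show ?thesis by (simp add: mult_single lower_poly.zero)
  next
    case (Y i)
    have "lex_exp (m - unit_exp (X i)) < lex_exp (unit_exp g + m)"
      using lex_exp_minus_unit[of m "X i"] lex_exp_unit_pos[of g]
      by (metis add_less_le_mono add_0 lex_exp_add)
    then show ?thesis using Y by (simp add: mult_single deriv_X_single lower_poly_single)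
  qed
  from lower_poly_add[OF this gen_op_lower[OF r, of g]] show ?thesis
    by (simp add: f monic_poly_def gen_op_add algebra_simps)
qed

text \<open>
  Elements that act on leading monomials like multiplication by the monomial of exponent \<open>d\<close>. They are closed
  under products, so that membership of a normal monomial follows from that of the generators.
\<close>

definition leading_shift :: "('n::finite weyl_gen \<Rightarrow>\<^sub>0 nat) \<Rightarrow> ('n, 'k::field) weyl_algebra set" where
  "leading_shift d = {a. \<forall>m. \<forall>f\<in>monic_poly m. weyl_op a f \<in> monic_poly (d + m)}"

lemma leading_shift_one: "1 \<in> leading_shift 0"
  by (simp add: leading_shift_def weyl_op_one)

lemma leading_shift_mult:
  "a \<in> leading_shift d \<Longrightarrow> b \<in> leading_shift e \<Longrightarrow> a * b \<in> leading_shift (d + e)"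
  by (simp add: leading_shift_def weyl_op_mult add.assoc)

lemma leading_shift_generator_power: "weyl_generator g ^ k \<in> leading_shift (Poly_Mapping.single g k)"
proof (induction k)
  case (Suc k)
  have "weyl_generator g \<in> leading_shift (unit_exp g)"
    by (simp add: leading_shift_def weyl_op_generator gen_op_monic)
  from leading_shift_mult[OF this Suc] show ?case
    by (simp add: single_add[symmetric])
qed (simp add: leading_shift_one)

lemma leading_shift_prod_powers:
  "prod_powers (\<lambda>i. weyl_generator (G i)) k xs \<in>
     leading_shift (sum_list (map (\<lambda>i. Poly_Mapping.single (G i) (k i)) xs))"
  by (induction xs) (simp_all add: leading_shift_one leading_shift_mult leading_shift_generator_power)

lemma leading_shift_normal_monomial: "normal_monomial m \<in> leading_shift m"
proof -
  have sl: "sum_list (map e enum_list) = (\<Sum>i\<in>UNIV. e i)"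
    for e :: "'a \<Rightarrow> 'a weyl_gen \<Rightarrow>\<^sub>0 nat"
    by (simp add: sum_list_distinct_conv_sum_set)
  have "(\<Sum>i\<in>UNIV. Poly_Mapping.single (X i) (Poly_Mapping.lookup m (X i))) +
      (\<Sum>i\<in>UNIV. Poly_Mapping.single (Y i) (Poly_Mapping.lookup m (Y i))) = m"
  proof (rule poly_mapping_eqI)
    fix g
    show "Poly_Mapping.lookup ((\<Sum>i\<in>UNIV. Poly_Mapping.single (X i) (Poly_Mapping.lookup m (X i))) +
      (\<Sum>i\<in>UNIV. Poly_Mapping.single (Y i) (Poly_Mapping.lookup m (Y i)))) g = Poly_Mapping.lookup m g"
      by (cases g) (simp_all add: lookup_add lookup_sum lookup_single when_def)
  qed
  then show ?thesis
    using leading_shift_mult[OF leading_shift_prod_powers leading_shift_prod_powers,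
        of X "\<lambda>i. Poly_Mapping.lookup m (X i)" enum_list Y "\<lambda>i. Poly_Mapping.lookup m (Y i)" enum_list]
    by (simp add: sl normal_monomial_def)
qed

section \<open>The Gauss valuation\<close>

text \<open>
  Inserting \<open>\<infinity>\<close> gives the zero polynomial the value \<open>\<infinity>\<close> and changes no other minimum.
\<close>

definition gauss :: "('k::field \<Rightarrow> 'g::linordered_group_add with_infty) \<Rightarrow> ('n, 'k) symbol_poly \<Rightarrow> 'g with_infty" where
  "gauss v f = Min (insert \<infinity> ((\<lambda>m. v (Poly_Mapping.lookup f m)) ` Poly_Mapping.keys f))"

lemma lookup_symbol_const_mult:
  "Poly_Mapping.lookup (symbol_const c * f) m = c * Poly_Mapping.lookup f m"
  by (induction f rule: fa_induct)
    (simp_all add: distrib_left lookup_add mult_single lookup_single when_def)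

context
  fixes v :: "'k::field \<Rightarrow> 'g::linordered_group_add with_infty"
  assumes val: "ring_valuation v"
begin

lemma gauss_le: "gauss v f \<le> v (Poly_Mapping.lookup f m)"
proof (cases "m \<in> Poly_Mapping.keys f")
  case False
  then show ?thesis by (simp add: in_keys_iff ring_valuation_zero[OF val])
qed (auto simp: gauss_def intro: Min_le)

lemma gauss_ge: "(\<And>m. \<gamma> \<le> v (Poly_Mapping.lookup f m)) \<Longrightarrow> \<gamma> \<le> gauss v f"
  by (auto simp: gauss_def)

lemma gauss_zero: "gauss v 0 = \<infinity>"
  by (simp add: gauss_def)

lemma gauss_attained:
  assumes "f \<noteq> 0"
  obtains \<gamma> m where "gauss v f = Fin \<gamma>" "v (Poly_Mapping.lookup f m) = Fin \<gamma>" "m \<in> Poly_Mapping.keys f"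
proof -
  let ?V = "(\<lambda>m. v (Poly_Mapping.lookup f m)) ` Poly_Mapping.keys f"
  have ne: "?V \<noteq> {}" using assms by simp
  then have "gauss v f = Min ?V" by (simp add: gauss_def min_absorb2)
  then have "gauss v f \<in> ?V" using ne by (metis Min_in finite_imageI finite_keys)
  then obtain m where m: "m \<in> Poly_Mapping.keys f" "gauss v f = v (Poly_Mapping.lookup f m)" by blast
  then obtain \<gamma> where "v (Poly_Mapping.lookup f m) = Fin \<gamma>"
    using ring_valuation_finite[OF val, of "Poly_Mapping.lookup f m"] by (auto simp: in_keys_iff)
  then show ?thesis using that m by simp
qed

lemma gauss_eq_infty: "gauss v f = \<infinity> \<longleftrightarrow> f = 0"
  by (metis gauss_attained gauss_zero Fin_neq_infty(1))

lemma gauss_add: "min (gauss v f) (gauss v g) \<le> gauss v (f + g)"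
proof (rule gauss_ge)
  fix m
  have "min (gauss v f) (gauss v g) \<le> min (v (Poly_Mapping.lookup f m)) (v (Poly_Mapping.lookup g m))"
    by (intro min.mono gauss_le)
  also have "\<dots> \<le> v (Poly_Mapping.lookup (f + g) m)"
    by (simp add: lookup_add ring_valuation_add[OF val])
  finally show "min (gauss v f) (gauss v g) \<le> v (Poly_Mapping.lookup (f + g) m)" .
qed

text \<open>
  Among the finitely many monomials whose coefficient attains the minimum, \<open>\<mu>\<close> is the largest.
\<close>

lemma gauss_leading:
  fixes f :: "('n::finite, 'k) symbol_poly"
  assumes "f \<noteq> 0"
  obtains \<gamma> \<mu> where "gauss v f = Fin \<gamma>" "v (Poly_Mapping.lookup f \<mu>) = Fin \<gamma>" "\<mu> \<in> Poly_Mapping.keys f"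
    "\<And>m. lex_exp \<mu> < lex_exp m \<Longrightarrow> Fin \<gamma> < v (Poly_Mapping.lookup f m)"
proof -
  obtain \<gamma> m0 where \<gamma>: "gauss v f = Fin \<gamma>"
    and m0: "v (Poly_Mapping.lookup f m0) = Fin \<gamma>" "m0 \<in> Poly_Mapping.keys f"
    using gauss_attained[OF assms] by blast
  let ?M = "{m \<in> Poly_Mapping.keys f. v (Poly_Mapping.lookup f m) = Fin \<gamma>}"
  have "Max (lex_exp ` ?M) \<in> lex_exp ` ?M" using m0 by (intro Max_in) auto
  then obtain \<mu> where \<mu>: "\<mu> \<in> ?M" "lex_exp \<mu> = Max (lex_exp ` ?M)" by auto
  have "Fin \<gamma> < v (Poly_Mapping.lookup f m)" if "lex_exp \<mu> < lex_exp m" for m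
  proof -
    have "m \<notin> ?M"
    proof
      assume "m \<in> ?M"
      then have "lex_exp m \<le> Max (lex_exp ` ?M)" by (intro Max_ge) auto
      then show False using that \<mu> by simp
    qed
    then have "v (Poly_Mapping.lookup f m) \<noteq> Fin \<gamma>"
      using ring_valuation_zero[OF val] by (auto simp: in_keys_iff)
    then show ?thesis using gauss_le[of f m] \<gamma> by simp
  qed
  then show ?thesis using that \<gamma> \<mu> by blast
qed

text \<open>
  Gauss's lemma for a deformed product \<open>T m n = x\<^sup>m\<^sup>+\<^sup>n + lower terms\<close> of monomials. With leading exponents \<open>\<mu>\<close>, \<open>\<nu>\<close>
  of \<open>f\<close>, \<open>g\<close> as in \<open>gauss_leading\<close>, a pair \<open>(m, n)\<close> contributes to the coefficient at \<open>\<mu> + \<nu>\<close> only if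
  \<open>m + n\<close> is at least \<open>\<mu> + \<nu>\<close>. Any such pair other than \<open>(\<mu>, \<nu>)\<close> has \<open>m\<close> above \<open>\<mu>\<close> or \<open>n\<close> above \<open>\<nu>\<close>, hence
  a contribution of strictly larger value, and nothing can cancel the contribution of \<open>(\<mu>, \<nu>)\<close>.
\<close>

lemma gauss_product:
  fixes f g :: "('n::finite, 'k) symbol_poly"
  assumes T: "\<And>m n. T m n \<in> monic_poly (m + n)"
  defines "h \<equiv> \<Sum>m\<in>Poly_Mapping.keys f. \<Sum>n\<in>Poly_Mapping.keys g.
      symbol_const (Poly_Mapping.lookup f m * Poly_Mapping.lookup g n) * T m n"
  shows "gauss v h = gauss v f + gauss v g"
proof (cases "f = 0 \<or> g = 0")
  case True
  then show ?thesis by (auto simp: h_def gauss_zero)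
next
  case False
  obtain \<gamma> \<mu> where \<gamma>: "gauss v f = Fin \<gamma>" "v (Poly_Mapping.lookup f \<mu>) = Fin \<gamma>" "\<mu> \<in> Poly_Mapping.keys f"
    and \<mu>: "\<And>m. lex_exp \<mu> < lex_exp m \<Longrightarrow> Fin \<gamma> < v (Poly_Mapping.lookup f m)"
    using gauss_leading[of f] False by metis
  obtain \<delta> \<nu> where \<delta>: "gauss v g = Fin \<delta>" "v (Poly_Mapping.lookup g \<nu>) = Fin \<delta>" "\<nu> \<in> Poly_Mapping.keys g"
    and \<nu>: "\<And>n. lex_exp \<nu> < lex_exp n \<Longrightarrow> Fin \<delta> < v (Poly_Mapping.lookup g n)"
    using gauss_leading[of g] False by metis
  let ?P = "Poly_Mapping.keys f \<times> Poly_Mapping.keys g"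
  define t where "t p k = Poly_Mapping.lookup f (fst p) * Poly_Mapping.lookup g (snd p) *
      Poly_Mapping.lookup (T (fst p) (snd p)) k" for p k
  have coeff: "Poly_Mapping.lookup h k = (\<Sum>p\<in>?P. t p k)" for k
    by (simp add: h_def t_def lookup_sum lookup_symbol_const_mult sum.cartesian_product case_prod_beta)
  have T_nat: "\<exists>j. Poly_Mapping.lookup (T m n) k = of_nat j" for m n k
  proof -
    obtain j where "Poly_Mapping.lookup (T m n - Poly_Mapping.single (m + n) 1) k = of_nat j"
      using T[of m n] lower_poly_lookup_of_nat by (force simp: monic_poly_def)
    then have "Poly_Mapping.lookup (T m n) k = of_nat (j + (if k = m + n then 1 else 0))"
      by (auto simp: lookup_minus lookup_single when_def algebra_simps split: if_splits)
    then show ?thesis by blast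
  qed
  have T_lead: "Poly_Mapping.lookup (T m n) (m + n) = 1" for m n
    using T[of m n] lower_poly_lookup_eq_0[of "T m n - Poly_Mapping.single (m + n) 1" "m + n" "m + n"]
    by (simp add: monic_poly_def lookup_minus)
  have T_above: "Poly_Mapping.lookup (T m n) k = 0" if "lex_exp (m + n) < lex_exp k" for m n k
    using T[of m n] lower_poly_lookup_eq_0[of "T m n - Poly_Mapping.single (m + n) 1" "m + n" k] that
    by (auto simp: monic_poly_def lookup_minus lookup_single when_def)
  have t_ge: "v (Poly_Mapping.lookup f (fst p)) + v (Poly_Mapping.lookup g (snd p)) \<le> v (t p k)" for p k
  proof -
    have nonneg: "Fin 0 \<le> v (Poly_Mapping.lookup (T (fst p) (snd p)) k)"
      using T_nat[of "fst p" "snd p" k] ring_valuation_of_nat_nonneg[OF val] by metis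
    have "x + Fin 0 = x" for x :: "'g with_infty" by (cases x) (simp_all add: infinity_with_infty_def[symmetric])
    then show ?thesis
      using with_infty_add_mono[OF order_refl nonneg,
          of "v (Poly_Mapping.lookup f (fst p)) + v (Poly_Mapping.lookup g (snd p))"]
      by (simp add: t_def ring_valuation_mult[OF val])
  qed
  have "Fin (\<gamma> + \<delta>) \<le> v (t p k)" for p k
    using order_trans[OF with_infty_add_mono[OF gauss_le[of f "fst p"] gauss_le[of g "snd p"]] t_ge[of p k]]
    by (simp add: \<gamma> \<delta>)
  then have ge: "Fin (\<gamma> + \<delta>) \<le> gauss v h"
    by (intro gauss_ge) (simp add: coeff ring_valuation_sum[OF val])
  have rest: "Fin (\<gamma> + \<delta>) < v (t p (\<mu> + \<nu>))" if "p \<noteq> (\<mu>, \<nu>)" for p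
  proof (cases "lex_exp (fst p + snd p) < lex_exp (\<mu> + \<nu>)")
    case True
    then show ?thesis by (simp add: t_def T_above ring_valuation_zero[OF val] order_less_le)
  next
    case False
    have "lex_exp \<mu> < lex_exp (fst p) \<or> lex_exp \<nu> < lex_exp (snd p)"
    proof (rule ccontr)
      assume "\<not> ?thesis"
      then have le: "lex_exp (fst p) \<le> lex_exp \<mu>" "lex_exp (snd p) \<le> lex_exp \<nu>" by auto
      then have "lex_exp (fst p) = lex_exp \<mu> \<and> lex_exp (snd p) = lex_exp \<nu>"
        using False add_less_le_mono[of "lex_exp (fst p)" "lex_exp \<mu>" "lex_exp (snd p)" "lex_exp \<nu>"]
          add_le_less_mono[of "lex_exp (fst p)" "lex_exp \<mu>" "lex_exp (snd p)" "lex_exp \<nu>"]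
        by (auto simp: lex_exp_add order_less_le)
      then show False using that by (simp add: lex_exp_inject prod_eq_iff)
    qed
    then have "Fin (\<gamma> + \<delta>) < v (Poly_Mapping.lookup f (fst p)) + v (Poly_Mapping.lookup g (snd p))"
      using \<mu> \<nu> gauss_le[of f "fst p"] gauss_le[of g "snd p"] \<gamma>(1) \<delta>(1)
      by (intro with_infty_add_strict_mono) auto
    then show ?thesis using t_ge by (rule order_less_le_trans)
  qed
  have "v (Poly_Mapping.lookup h (\<mu> + \<nu>)) = v (t (\<mu>, \<nu>) (\<mu> + \<nu>) + (\<Sum>p\<in>?P - {(\<mu>, \<nu>)}. t p (\<mu> + \<nu>)))"
    unfolding coeff using \<gamma>(3) \<delta>(3) by (subst sum.remove[of _ "(\<mu>, \<nu>)"]) auto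
  also have "\<dots> = v (t (\<mu>, \<nu>) (\<mu> + \<nu>))"
  proof (rule ring_valuation_add_dominant[OF val])
    have "v (t (\<mu>, \<nu>) (\<mu> + \<nu>)) = Fin (\<gamma> + \<delta>)"
      by (simp add: t_def T_lead ring_valuation_mult[OF val] \<gamma> \<delta>)
    moreover have "Fin (\<gamma> + \<delta>) < v (\<Sum>p\<in>?P - {(\<mu>, \<nu>)}. t p (\<mu> + \<nu>))"
      using rest by (intro ring_valuation_sum_strict[OF val]) auto
    ultimately show "v (t (\<mu>, \<nu>) (\<mu> + \<nu>)) < v (\<Sum>p\<in>?P - {(\<mu>, \<nu>)}. t p (\<mu> + \<nu>))" by simp
  qed
  also have "\<dots> = Fin (\<gamma> + \<delta>)"
    by (simp add: t_def T_lead ring_valuation_mult[OF val] \<gamma> \<delta>)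
  finally have "gauss v h \<le> Fin (\<gamma> + \<delta>)" using gauss_le[of h "\<mu> + \<nu>"] by simp
  then show ?thesis using ge by (simp add: \<gamma> \<delta>)
qed

lemma ring_valuation_gauss_symbol:
  "ring_valuation (\<lambda>a :: ('n::finite, 'k) weyl_algebra. gauss v (symbol a))"
proof -
  have "gauss v (symbol a) = \<infinity> \<longleftrightarrow> a = 0" for a :: "('n, 'k) weyl_algebra"
    by (metis gauss_eq_infty normal_form_symbol normal_form_zero symbol_def weyl_op_zero)
  moreover have "gauss v (symbol (a * b)) = gauss v (symbol a) + gauss v (symbol b)"
    for a b :: "('n, 'k) weyl_algebra"
  proof -
    have "weyl_op (normal_monomial m) (Poly_Mapping.single n 1 :: ('n, 'k) symbol_poly) \<in> monic_poly (m + n)"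
      for m n
    proof -
      have "Poly_Mapping.single n 1 \<in> monic_poly n" by (simp add: monic_poly_def lower_poly.zero)
      then show ?thesis using leading_shift_normal_monomial[of m] unfolding leading_shift_def by blast
    qed
    then show ?thesis unfolding symbol_mult by (rule gauss_product)
  qed
  moreover have "min (gauss v (symbol a)) (gauss v (symbol b)) \<le> gauss v (symbol (a + b))"
    for a b :: "('n, 'k) weyl_algebra"
    using gauss_add by (simp add: symbol_def weyl_op_add)
  ultimately show ?thesis by (simp add: ring_valuation_def)
qed

lemma gauss_symbol_const: "gauss v (symbol (weyl_const c :: ('n, 'k) weyl_algebra)) = v c"
proof -
  have "symbol (weyl_const c :: ('n, 'k) weyl_algebra) = symbol_const c" by (simp add: symbol_def weyl_op_const)
  then show ?thesis by (simp add: gauss_def ring_valuation_zero[OF val])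
qed

end

theorem corollary2p3:
  fixes v :: "'k::field \<Rightarrow> 'g::linordered_group_add with_infty"
    and \<iota> :: "('n::finite, 'k) weyl_algebra \<Rightarrow> 'd::division_ring"
  assumes "skewfield_of_fractions \<iota>"
    and "valuation v" and "surj v"
  shows "\<exists>w :: 'd \<Rightarrow> 'g with_infty. valuation w \<and> (\<forall>c. w (\<iota> (weyl_const c)) = v c)"
proof -
  have v: "ring_valuation v" using assms(2) by (simp add: valuation_iff_ring_valuation)
  obtain w where "valuation w" "\<And>a. w (\<iota> a) = gauss v (symbol a)"
    using ring_valuation_extends_to_fractions[OF ring_valuation_gauss_symbol[OF v] assms(1)] by blast
  then show ?thesis using gauss_symbol_const[OF v] by metis
qed

end
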